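(* If $\nu+2>0$ and $x\in(0,2)$, then $$\mathbf L_\nu(x)-\frac{x^\nu\sinh x}{2^\nu\sqrt\pi\,\Gamma\left(\nu+\frac32\right)}=\int_1^\infty\int_0^{[u]}\frac{\partial}{\partial u}\Big(\Gamma(u+1)\,I_{u+\frac12}(x)\Big)\,\mathfrak d_s\left(\frac{\beta(s)}{\Gamma(s+1)}\right)\mathrm du\,\mathrm ds,$$ where $$\beta(s)=-\frac{\left(\frac x2\right)^{\nu+\frac12}}{\Gamma\left(\nu+\frac12\right)}\,\frac{e^{\mathrm i\pi s}\left(\frac x2\right)^s}{\Gamma(s+1)\left(s+\nu+\frac12\right)}.$$
   Context: $I_\nu(x)=\sum_{n\ge0}\frac{(x/2)^{2n+\nu}}{\Gamma(n+\nu+1)\,n!}$ is the modified Bessel function of the first kind and $\mathbf L_\nu(x)=\sum_{n\ge0}\frac{(x/2)^{2n+\nu+1}}{\Gamma(n+\frac32)\Gamma(n+\nu+\frac32)}$ is the modified Struve function. $[x]$ and $\{x\}=x-[x]$ denote the integer and fractional part of a real number $x$. The operator $\mathfrak d_s$ is $\mathfrak d_s=1+\{s\}\frac{\mathrm d}{\mathrm ds}$, i.e. $\mathfrak d_s f(s)=f(s)+\{s\}f'(s)$, with $x$ held fixed. In the double integral, $u$ runs over $(1,\infty)$ and, for each $u$, $s$ runs over $(0,[u])$.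
   Formalization: ν = −3/2 is excluded (there the right side is 0 but the left is I_{3/2}(x) > 0), and for −2 < ν < −1/2 the inner integral, divergent at s = −ν−1/2, is read as Hadamard's finite part; for ν ≥ −1/2 it is the ordinary integral. *)

theory Defs
  imports "HOL-Analysis.Analysis"
begin

(* Gamma is 0 at its poles and division by 0 gives 0, so a quotient by Gamma at a
   nonpositive integer vanishes: this is the usual convention 1/Gamma = 0 there. *)

definition bessel_I :: "real \<Rightarrow> real \<Rightarrow> real" where
  "bessel_I \<nu> x =
     (\<Sum>n. (x / 2) powr (2 * real n + \<nu>) / (Gamma (real n + \<nu> + 1) * fact n))"

definition struve_L :: "real \<Rightarrow> real \<Rightarrow> real" where
  "struve_L \<nu> x =
     (\<Sum>n. (x / 2) powr (2 * real n + \<nu> + 1) / (Gamma (real n + 3/2) * Gamma (real n + \<nu> + 3/2)))"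

definition euler_op :: "(real \<Rightarrow> complex) \<Rightarrow> real \<Rightarrow> complex" where
  "euler_op f s = f s + of_real (frac s) * vector_derivative f (at s)"

definition struve_beta :: "real \<Rightarrow> real \<Rightarrow> real \<Rightarrow> complex" where
  "struve_beta \<nu> x s =
     - of_real ((x / 2) powr (\<nu> + 1/2) / Gamma (\<nu> + 1/2)) *
       (exp (\<i> * of_real pi * of_real s) * of_real ((x / 2) powr s) /
        of_real (Gamma (s + 1) * (s + \<nu> + 1/2)))"

(* If s + nu + 1/2 vanishes for some s = p inside the range of integration, the integrand
   has a double pole at p and is not Lebesgue integrable. The integral over (a,b) is therefore
   taken in Hadamard's finite-part sense: cut out the balls of radius e around the points where
   the integrand is not locally integrable, discard a polynomial in 1/e without constant term,
   and let e tend to 0. For integrable f there are no such points and nothing is cut out, so this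
   is the Lebesgue integral (finite_part_integral_eq_LINT); with the zero polynomial
   it is the Cauchy principal value. *)

definition singular_points :: "(real \<Rightarrow> complex) \<Rightarrow> real \<Rightarrow> real \<Rightarrow> real set" where
  "singular_points f a b =
     {p \<in> {a<..<b}. \<forall>e>0. \<not> set_integrable lborel ({a<..<b} \<inter> ball p e) f}"

definition cut_interval :: "(real \<Rightarrow> complex) \<Rightarrow> real \<Rightarrow> real \<Rightarrow> real \<Rightarrow> real set" where
  "cut_interval f a b e = {a<..<b} - (\<Union>p\<in>singular_points f a b. ball p e)"

definition has_finite_part_integral ::
    "(real \<Rightarrow> complex) \<Rightarrow> real \<Rightarrow> real \<Rightarrow> complex \<Rightarrow> bool" where
  "has_finite_part_integral f a b J \<longleftrightarrow>
     (\<forall>\<^sub>F e in at_right 0. set_integrable lborel (cut_interval f a b e) f) \<and>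
     (\<exists>q :: complex poly. coeff q 0 = 0 \<and>
        ((\<lambda>e. (LINT s:cut_interval f a b e|lborel. f s) - poly q (of_real (1 / e))) \<longlongrightarrow> J)
          (at_right 0))"

definition finite_part_integral :: "(real \<Rightarrow> complex) \<Rightarrow> real \<Rightarrow> real \<Rightarrow> complex" where
  "finite_part_integral f a b = (THE J. has_finite_part_integral f a b J)"

lemma poly_one_over_tendsto_imp_zero:
  fixes q :: "complex poly"
  assumes "coeff q 0 = 0"
    and lim: "((\<lambda>e::real. poly q (of_real (1 / e))) \<longlongrightarrow> l) (at_right 0)"
  shows "q = 0"
proof (rule ccontr)
  assume "q \<noteq> 0"
  have "degree q \<noteq> 0"
  proof
    assume "degree q = 0"
    then obtain c where "q = [:c:]" by (rule degree_eq_zeroE)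
    with assms(1) \<open>q \<noteq> 0\<close> show False by simp
  qed
  then have 1: "filterlim (poly q) at_infinity at_infinity"
    by (intro filterlim_poly_at_infinity) simp
  have "filterlim (\<lambda>e::real. 1 / e) at_infinity (at_right 0)"
    using filterlim_mono[OF filterlim_inverse_at_top_right at_top_le_at_infinity order_refl]
    by (simp add: divide_inverse)
  then have "filterlim (\<lambda>e::real. complex_of_real (1 / e)) at_infinity (at_right 0)"
    by (simp add: filterlim_at_infinity_conv_norm_at_top norm_divide)
  then have "filterlim (\<lambda>e::real. poly q (of_real (1 / e))) at_infinity (at_right 0)"
    by (rule filterlim_compose[OF 1])
  then show False
    using lim not_tendsto_and_filterlim_at_infinity trivial_limit_at_right_real by blast
qed

lemma has_finite_part_integral_unique:
  assumes "has_finite_part_integral f a b J" "has_finite_part_integral f a b J'"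
  shows "J = J'"
proof -
  let ?I = "\<lambda>e. LINT s:cut_interval f a b e|lborel. f s"
  obtain q where q: "coeff q 0 = 0"
      "((\<lambda>e. ?I e - poly q (of_real (1 / e))) \<longlongrightarrow> J) (at_right 0)"
    using assms(1) unfolding has_finite_part_integral_def by blast
  obtain r where r: "coeff r 0 = 0"
      "((\<lambda>e. ?I e - poly r (of_real (1 / e))) \<longlongrightarrow> J') (at_right 0)"
    using assms(2) unfolding has_finite_part_integral_def by blast
  have "((\<lambda>e. poly (r - q) (of_real (1 / e))) \<longlongrightarrow> J - J') (at_right 0)"
    using tendsto_diff[OF q(2) r(2)] by simp
  then have "r - q = 0"
    using q(1) r(1) by (intro poly_one_over_tendsto_imp_zero) auto
  then show ?thesis
    using q(2) r(2) tendsto_unique[OF trivial_limit_at_right_real] by auto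
qed

lemma finite_part_integral_eqI:
  "has_finite_part_integral f a b J \<Longrightarrow> finite_part_integral f a b = J"
  unfolding finite_part_integral_def
  by (rule the_equality) (auto intro: has_finite_part_integral_unique)

lemma has_finite_part_integral_LINT:
  assumes "set_integrable lborel {a<..<b} f"
  shows "has_finite_part_integral f a b (LINT s:{a<..<b}|lborel. f s)"
proof -
  have "set_integrable lborel ({a<..<b} \<inter> ball p 1) f" for p
    by (rule set_integrable_subset[OF assms]) auto
  then have "singular_points f a b = {}"
    unfolding singular_points_def using zero_less_one by blast
  then have "cut_interval f a b e = {a<..<b}" for e
    by (simp add: cut_interval_def)
  then show ?thesis
    using assms unfolding has_finite_part_integral_def
    by (auto intro!: exI[of _ 0])
qed

lemma finite_part_integral_eq_LINT:
  assumes "set_integrable lborel {a<..<b} f"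
  shows "finite_part_integral f a b = (LINT s:{a<..<b}|lborel. f s)"
  using has_finite_part_integral_LINT[OF assms] by (rule finite_part_integral_eqI)

end

theory Submission
  imports Defs
begin

text \<open>
  Put \<open>f(s) = \<beta>(s) / \<Gamma>(s + 1)\<close> and \<open>g(u) = \<Gamma>(u + 1) I\<^bsub>u + 1/2\<^esub>(x)\<close>.
  The Neumann type expansion of \<open>L\<^sub>\<nu>\<close> in the functions \<open>I\<^bsub>n + 1/2\<^esub>\<close> has the
  hyperbolic sine term as its term \<open>n = 0\<close>, and its term \<open>n \<ge> 1\<close> is \<open>- f(n) g(n)\<close>.
  Integrating \<open>f(s) + (s - k) f'(s)\<close> over \<open>[k, k + 1]\<close> gives \<open>f(k + 1)\<close>, so the inner
  integral is the partial sum \<open>f(1) + \<dots> + f([u])\<close>. If the pole \<open>p = - \<nu> - 1/2\<close> of \<open>f\<close>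
  is in the range of integration, cutting out the ball of radius \<open>e\<close> changes this value by a multiple
  of \<open>1 / e\<close> and an error that vanishes in the limit.
  As \<open>g\<close> decreases to \<open>0\<close> for \<open>0 < x < 2\<close>, Abel summation turns
  the outer integral into \<open>- \<Sum> f(n) g(n)\<close>.
\<close>

subsection \<open>The Struve function as a series of Bessel functions\<close>

text \<open>The duplication formula for Gamma at half-integers turns the series into the odd Taylor
  series of sinh. This is the Bessel factor of the term of index 0 in the expansion of the Struve
  function.\<close>

lemma bessel_I_half:
  assumes "x > 0"
  shows "bessel_I (1/2) x = (x/2) powr (-1/2) * sinh x / sqrt pi"
proof -
  have gam: "Gamma (real m + 3/2) * fact m * 2 ^ (2*m+1) = sqrt pi * fact (2*m+1)" for m
  proof (induction m)
    case 0
    have "Gamma (1/2 + 1 :: real) = 1/2 * Gamma (1/2)"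
      using nonpos_Ints_nonpos by (intro Gamma_plus1) force
    then show ?case by (simp add: Gamma_one_half_real)
  next
    case (Suc m)
    have "real m + 3/2 \<notin> \<int>\<^sub>\<le>\<^sub>0" using nonpos_Ints_nonpos by force
    then have "Gamma (real (Suc m) + 3/2) = (real m + 3/2) * Gamma (real m + 3/2)"
      using Gamma_plus1[of "real m + 3/2"] by (simp add: add_ac)
    then have "Gamma (real (Suc m) + 3/2) * fact (Suc m) * 2 ^ (2 * Suc m + 1)
        = (2 * real m + 3) * (2 * real m + 2) * (Gamma (real m + 3/2) * fact m * 2 ^ (2*m+1))"
      by (simp add: algebra_simps)
    also have "\<dots> = sqrt pi * fact (2 * Suc m + 1)"
      unfolding Suc by (simp add: algebra_simps)
    finally show ?case .
  qed
  have "(\<lambda>n. if even n then 0 else x ^ n /\<^sub>R fact n) sums sinh x"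
    by (rule sinh_converges)
  moreover have "strict_mono (\<lambda>m::nat. 2*m+1)"
    by (auto simp: strict_mono_def)
  ultimately have "(\<lambda>m. x ^ (2*m+1) / fact (2*m+1)) sums sinh x"
    by (subst (asm) sums_mono_reindex[symmetric, of "\<lambda>m::nat. 2*m+1"])
       (auto elim!: oddE simp: divide_inverse mult_ac)
  then have "(\<lambda>m. (x/2) powr (-1/2) / sqrt pi * (x ^ (2*m+1) / fact (2*m+1)))
      sums ((x/2) powr (-1/2) / sqrt pi * sinh x)"
    by (rule sums_mult)
  moreover have "(x/2) powr (-1/2) / sqrt pi * (x ^ (2*m+1) / fact (2*m+1))
      = (x / 2) powr (2 * real m + 1/2) / (Gamma (real m + 1/2 + 1) * fact m)" for m
  proof -
    have "(x/2) powr (2 * real m + 1/2) = (x/2) powr (-1/2) * (x/2) powr (real (2*m+1))"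
      by (simp add: powr_add[symmetric] add_ac)
    also have "\<dots> = (x/2) powr (-1/2) * (x ^ (2*m+1) / 2 ^ (2*m+1))"
      using assms by (subst powr_realpow) (auto simp: power_divide)
    finally have 1: "(x/2) powr (2 * real m + 1/2) = \<dots>" .
    have 2: "Gamma (real m + 1/2 + 1) * fact m = sqrt pi * fact (2*m+1) / 2 ^ (2*m+1)"
      using gam[of m] by (simp add: field_simps add_ac)
    show ?thesis unfolding 1 2 by (simp add: divide_simps)
  qed
  ultimately show ?thesis
    unfolding bessel_I_def by (simp add: sums_iff)
qed

text \<open>This is the partial fraction decomposition of m! / (a (a + 1) ... (a + m)). Pascal's
  rule writes the sum for m + 1 as the sum for m at a minus the one at a + 1, so the induction
  leaves \<open>a\<close> arbitrary.\<close>

lemma sum_binomial_reciprocal: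
  fixes a :: real
  assumes "a \<notin> \<int>\<^sub>\<le>\<^sub>0"
  shows "(\<Sum>k\<le>m. (-1) ^ k * real (m choose k) / (real k + a)) = fact m / pochhammer a (Suc m)"
  using assms
proof (induction m arbitrary: a)
  case 0
  then show ?case by simp
next
  case (Suc m)
  have a1: "a + 1 \<notin> \<int>\<^sub>\<le>\<^sub>0"
    using Suc.prems by (metis add_diff_cancel_right' nonpos_Ints_diff_Nats Nats_1)
  have nz: "pochhammer a n \<noteq> 0" "pochhammer (a+1) n \<noteq> 0" for n
    using Suc.prems a1 pochhammer_eq_0_imp_nonpos_Int by blast+
  define c where "c n k = (-1) ^ k * real (n choose k)" for n k
  have c0: "c m (Suc m) = 0" by (simp add: c_def)
  have "(\<Sum>k\<le>Suc m. c (Suc m) k / (real k + a))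
      = 1 / a + (\<Sum>k\<le>m. c (Suc m) (Suc k) / (real (Suc k) + a))"
    by (subst sum.atMost_Suc_shift) (simp add: c_def)
  also have "(\<Sum>k\<le>m. c (Suc m) (Suc k) / (real (Suc k) + a))
      = (\<Sum>k\<le>m. c m (Suc k) / (real (Suc k) + a)) - (\<Sum>k\<le>m. c m k / (real k + (a + 1)))"
    by (subst sum_subtractf[symmetric], rule sum.cong)
       (auto simp: c_def field_simps add_divide_distrib diff_divide_distrib)
  also have "1 / a + ((\<Sum>k\<le>m. c m (Suc k) / (real (Suc k) + a)) - (\<Sum>k\<le>m. c m k / (real k + (a + 1))))
     = (\<Sum>k\<le>Suc m. c m k / (real k + a)) - (\<Sum>k\<le>m. c m k / (real k + (a + 1)))"
    by (subst sum.atMost_Suc_shift) (simp add: c_def)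
  also have "(\<Sum>k\<le>Suc m. c m k / (real k + a)) = (\<Sum>k\<le>m. c m k / (real k + a))"
    using c0 by simp
  also have "\<dots> = fact m / pochhammer a (Suc m)"
    unfolding c_def by (rule Suc.IH[OF Suc.prems])
  also have "(\<Sum>k\<le>m. c m k / (real k + (a + 1))) = fact m / pochhammer (a + 1) (Suc m)"
    unfolding c_def by (rule Suc.IH[OF a1])
  also have "fact m / pochhammer a (Suc m) - fact m / pochhammer (a + 1) (Suc m)
      = fact (Suc m) / pochhammer a (Suc (Suc m))"
  proof -
    have p1: "pochhammer a (Suc (Suc m)) = a * pochhammer (a+1) (Suc m)"
      and p2: "pochhammer a (Suc (Suc m)) = pochhammer a (Suc m) * (a + real (Suc m))"
      by (rule pochhammer_rec, subst pochhammer_rec', simp add: mult_ac)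
    have "fact m / pochhammer a (Suc m) = fact m * (a + real (Suc m)) / pochhammer a (Suc (Suc m))"
      using nz(1)[of "Suc (Suc m)"] nz(1)[of "Suc m"] unfolding p2 by (simp add: divide_simps)
    moreover have "fact m / pochhammer (a + 1) (Suc m) = fact m * a / pochhammer a (Suc (Suc m))"
      using nz(1)[of "Suc (Suc m)"] nz(2)[of "Suc m"] unfolding p1 by (simp add: divide_simps)
    ultimately show ?thesis by (simp add: diff_divide_distrib[symmetric] algebra_simps)
  qed
  finally show ?case by (simp add: c_def)
qed

text \<open>Rows and antidiagonals are two groupings of one unconditionally convergent double
  series, related by the bijection taking (m, k) with k at most m to (k, m - k).\<close>

lemma suminf_antidiagonal:
  fixes a :: "nat \<Rightarrow> nat \<Rightarrow> real"
  assumes "(\<lambda>(k, j). norm (a k j)) summable_on UNIV \<times> UNIV"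
  obtains S where "(\<lambda>k. \<Sum>j. a k j) sums S" "(\<lambda>m. \<Sum>k\<le>m. a k (m - k)) sums S"
proof -
  have summ: "(\<lambda>(k, j). a k j) summable_on UNIV \<times> UNIV"
    using Infinite_Sum.abs_summable_summable[of "\<lambda>(k, j). a k j"] assms
    by (simp add: case_prod_unfold)
  then obtain S where S: "((\<lambda>(k, j). a k j) has_sum S) (UNIV \<times> UNIV)"
    by (auto simp: summable_on_def)
  have "(a k) summable_on UNIV" for k
  proof -
    have "(\<lambda>j. norm (a k j)) summable_on UNIV"
      using assms Infinite_Sum.abs_summable_on_Sigma_iff[of "\<lambda>(k, j). a k j" UNIV "\<lambda>_. UNIV"]
      by (simp add: case_prod_unfold)
    then show ?thesis by (rule Infinite_Sum.abs_summable_summable)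
  qed
  then have row: "((\<lambda>j. a k j) has_sum (\<Sum>j. a k j)) UNIV" for k
    using has_sum_imp_sums has_sum_infsum sums_unique by metis
  have rows: "(\<lambda>k. \<Sum>j. a k j) sums S"
    using S row by (intro has_sum_imp_sums has_sum_SigmaD[OF S]) auto
  have bij: "bij_betw (\<lambda>(m, k). (k, m - k)) (SIGMA m:UNIV. {..m}) (UNIV \<times> (UNIV :: nat set))"
    by (rule bij_betwI[where g = "\<lambda>(k, j). (k + j, k)"]) auto
  have "((\<lambda>(m, k). a k (m - k)) has_sum S) (SIGMA m:UNIV. {..m})"
    using S by (subst (asm) has_sum_reindex_bij_betw[OF bij, symmetric]) (simp add: case_prod_unfold)
  then have "(\<lambda>m. \<Sum>k\<le>m. a k (m - k)) sums S"
    by (intro has_sum_imp_sums, elim has_sum_SigmaD) (auto intro: has_sum_finite)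
  with rows show ?thesis by (intro that) simp_all
qed

text \<open>On the positive axis Gamma has its minimum just below 3/2 and increases from there on.
  The majorants below use this to replace Gamma values in denominators by
  \<open>Gamma (3/2)\<close>.\<close>

lemma Gamma_ge_three_halves_mono:
  assumes "3/2 \<le> x" "x \<le> y"
  shows "Gamma x \<le> Gamma (y :: real)"
  using Gamma_real_strict_mono[of x y] assms by (cases "x = y") auto

lemma summable_bessel_I:
  assumes "x > 0" "\<mu> \<ge> 1/2"
  shows "summable (\<lambda>n. (x / 2) powr (2 * real n + \<mu>) / (Gamma (real n + \<mu> + 1) * fact n))"
proof (rule summable_comparison_test')
  define y where "y = x / 2"
  show "summable (\<lambda>n. y powr \<mu> / Gamma (3/2) * (inverse (fact n) * (y ^ 2) ^ n))"
    by (intro summable_mult summable_exp)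
  fix n :: nat
  have y: "y > 0" using assms by (simp add: y_def)
  have "Gamma (3/2 :: real) > 0" by (rule Gamma_real_pos) simp
  moreover have "Gamma (3/2) \<le> Gamma (real n + \<mu> + 1)"
    using assms by (intro Gamma_ge_three_halves_mono) auto
  ultimately have G: "0 < Gamma (3/2 :: real)" "Gamma (3/2) \<le> Gamma (real n + \<mu> + 1)"
    "0 < Gamma (real n + \<mu> + 1)" by linarith+
  have "y powr (2 * real n + \<mu>) = y powr \<mu> * y powr (real (2 * n))"
    by (simp add: powr_add[symmetric] add_ac)
  also have "y powr (real (2 * n)) = (y ^ 2) ^ n"
    using y by (subst powr_realpow) (simp_all add: power_mult)
  finally have pw: "y powr (2 * real n + \<mu>) = y powr \<mu> * (y ^ 2) ^ n" .
  have "norm (y powr (2 * real n + \<mu>) / (Gamma (real n + \<mu> + 1) * fact n))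
      = y powr \<mu> * (y ^ 2) ^ n / fact n * (1 / Gamma (real n + \<mu> + 1))"
    using G unfolding pw by (simp add: abs_mult)
  also have "\<dots> \<le> y powr \<mu> * (y ^ 2) ^ n / fact n * (1 / Gamma (3/2))"
    using G by (intro mult_left_mono divide_left_mono) auto
  finally show "norm ((x / 2) powr (2 * real n + \<mu>) / (Gamma (real n + \<mu> + 1) * fact n))
      \<le> y powr \<mu> / Gamma (3/2) * (inverse (fact n) * (y ^ 2) ^ n)"
    unfolding y_def[symmetric] by (simp only: divide_inverse mult_1 mult_ac)
qed

text \<open>After expanding the Bessel functions, the antidiagonal sums are evaluated by
  \<open>sum_binomial_reciprocal\<close>.\<close>

lemma struve_L_bessel_series:
  fixes \<nu> x :: real
  assumes "x > 0" and a: "\<nu> + 1/2 \<notin> \<int>\<^sub>\<le>\<^sub>0"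
  shows "(\<lambda>k. (x/2) powr (\<nu> + 1/2) / Gamma (\<nu> + 1/2) *
            ((-1) ^ k * (x/2) ^ k / (fact k * (real k + (\<nu> + 1/2)))) * bessel_I (real k + 1/2) x)
         sums struve_L \<nu> x"
proof -
  define y where "y = x / 2"
  define a where "a = \<nu> + 1/2"
  have y: "y > 0" using assms by (simp add: y_def)
  have a: "a \<notin> \<int>\<^sub>\<le>\<^sub>0" using assms by (simp add: a_def)
  \<comment> \<open>\<open>A k j\<close> is the j-th term of the k-th Bessel series times its
    coefficient, with the common factor \<open>y powr (\<nu> + 1) / Gamma a\<close> taken
    out.\<close>
  define A where "A k j = (-1) ^ k * y ^ (2 * (k + j)) /
      (fact k * fact j * (real k + a) * Gamma (real (k + j) + 3/2))" for k j
  have G: "Gamma (3/2 :: real) > 0" "Gamma (real n + 3/2) > 0" for n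
    by (rule Gamma_real_pos, simp)+
  \<comment> \<open>\<open>a\<close> may be negative, so 1 / (k + a) is not monotone in k; as a null
    sequence it is still bounded by some \<open>K\<close>.\<close>
  have "filterlim (\<lambda>k. a + real k) at_top sequentially"
    by (rule filterlim_tendsto_add_at_top[OF tendsto_const filterlim_real_sequentially])
  then have "(\<lambda>k. 1 / (real k + a)) \<longlonglongrightarrow> 0"
    unfolding divide_inverse mult_1 add.commute[of _ a] by (rule tendsto_inverse_0_at_top)
  then have "Bseq (\<lambda>k. 1 / (real k + a))"
    using convergentI convergent_imp_Bseq by blast
  then obtain K where K: "K > 0" "\<And>k. \<bar>1 / (real k + a)\<bar> \<le> K"
    by (auto simp: Bseq_def)
  define e where "e k = (y ^ 2) ^ k / fact k" for k :: nat
  have e_nonneg: "e k \<ge> 0" for k by (simp add: e_def)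
  have e_sum: "e summable_on UNIV"
    using summable_exp[of "y^2"]
    by (intro norm_summable_imp_summable_on) (simp add: e_def divide_inverse mult_ac)
  have e_norm: "norm (K / Gamma (3/2) * e k * e j) = K / Gamma (3/2) * e k * e j" for k j
    using G K e_nonneg by simp
  \<comment> \<open>The majorant is a constant times the product of two exponential series in
    \<open>y ^ 2\<close>.\<close>
  have "(\<lambda>p. norm ((\<lambda>(k, j). (K / Gamma (3/2)) * e k * e j) p)) summable_on UNIV \<times> UNIV"
  proof (subst Infinite_Sum.abs_summable_on_Sigma_iff, intro conjI ballI)
    show "(\<lambda>j. norm ((\<lambda>(k, j). (K / Gamma (3/2)) * e k * e j) (k, j))) summable_on UNIV" for k
      unfolding prod.case e_norm by (intro summable_on_cmult_right e_sum)
    have "norm (infsum e UNIV * (K / Gamma (3/2) * e k)) = infsum e UNIV * (K / Gamma (3/2)) * e k" for k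
      using G K e_nonneg infsum_nonneg[of UNIV e] by (simp add: abs_mult)
    then have "(\<lambda>k. norm (infsum e UNIV * (K / Gamma (3/2) * e k))) summable_on UNIV"
      using e_sum by (simp only: summable_on_cmult_right)
    then show "(\<lambda>k. norm (\<Sum>\<^sub>\<infinity>j. norm ((\<lambda>(k, j). (K / Gamma (3/2)) * e k * e j) (k, j)))) summable_on UNIV"
      unfolding prod.case e_norm infsum_cmult_right' by (simp add: mult_ac)
  qed
  then have "(\<lambda>p. norm ((\<lambda>(k, j). A k j) p)) summable_on UNIV \<times> UNIV"
  proof (rule Infinite_Sum.abs_summable_on_comparison_test, clarify)
    fix k j :: nat
    have "norm (A k j) = e k * e j * (\<bar>1 / (real k + a)\<bar> * (1 / Gamma (real (k + j) + 3/2)))"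
      using G(2)[of "k + j"] y
      by (simp add: A_def e_def abs_mult power_add power_mult power_abs power2_eq_square)
    also have "\<dots> \<le> e k * e j * (K * (1 / Gamma (3/2)))"
      using G K Gamma_ge_three_halves_mono[of "3/2" "real (k + j) + 3/2"] e_nonneg
      by (intro mult_left_mono mult_mono divide_left_mono) auto
    also have "\<dots> \<le> norm (K / Gamma (3/2) * e k * e j)"
      unfolding e_norm by (simp add: mult_ac)
    finally show "norm (A k j) \<le> norm (K / Gamma (3/2) * e k * e j)" .
  qed
  then have "(\<lambda>(k, j). norm (A k j)) summable_on UNIV \<times> UNIV"
    by (simp add: case_prod_unfold)
  then obtain S where S: "(\<lambda>k. \<Sum>j. A k j) sums S" "(\<lambda>m. \<Sum>k\<le>m. A k (m - k)) sums S"
    by (rule suminf_antidiagonal)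
  have pw: "y powr (\<nu> + 1) * y ^ n = y powr (real n + \<nu> + 1)" for n
    using y by (simp add: powr_realpow[symmetric] powr_add[symmetric] add_ac)
  \<comment> \<open>The factor \<open>y powr (-1/2)\<close> in \<open>c\<close> offsets the 1/2 in
    the order of the Bessel function and lowers the exponent \<nu> + 1 of the prefactor to
    \<open>a\<close>.\<close>
  have row: "y powr (\<nu> + 1) / Gamma a * (\<Sum>j. A k j) = y powr a / Gamma a *
            ((-1) ^ k * y ^ k / (fact k * (real k + a))) * bessel_I (real k + 1/2) x" for k
  proof -
    define c where "c = (-1) ^ k * y ^ k / (fact k * (real k + a)) * y powr (-1/2)"
    define b where "b j = y powr (2 * real j + (real k + 1/2)) /
        (Gamma (real j + (real k + 1/2) + 1) * fact j)" for j
    have "b sums bessel_I (real k + 1/2) x"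
      using summable_bessel_I[of x "real k + 1/2"] assms
      unfolding b_def bessel_I_def y_def by (simp add: summable_sums)
    then have "(\<lambda>j. c * b j) sums (c * bessel_I (real k + 1/2) x)"
      by (rule sums_mult)
    moreover have "c * b j = A k j" for j
    proof -
      have "y powr (2 * real j + (real k + 1/2)) = y powr (1/2) * y powr (real (2 * j + k))"
        by (simp add: powr_add[symmetric] add_ac)
      also have "y powr (real (2 * j + k)) = y ^ (2 * j + k)"
        using y by (rule powr_realpow)
      finally have "y powr (-1/2) * y powr (2 * real j + (real k + 1/2)) = y ^ (2 * j + k)"
        using y by (simp add: mult.assoc[symmetric] powr_add[symmetric])
      then have "y ^ k * (y powr (-1/2) * y powr (2 * real j + (real k + 1/2))) = y ^ (2 * (k + j))"
        by (simp add: power_add[symmetric] algebra_simps)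
      then show ?thesis
        unfolding A_def c_def b_def by (simp add: add_ac mult_ac)
    qed
    ultimately have "(\<Sum>j. A k j) = c * bessel_I (real k + 1/2) x"
      by (simp add: sums_iff)
    moreover have "y powr (\<nu> + 1) * y powr (-1/2) = y powr a"
      by (simp add: powr_add[symmetric] a_def add_ac)
    ultimately show ?thesis by (simp add: c_def mult_ac)
  qed
  \<comment> \<open>On k + j = m only the signed binomial coefficient and 1 / (k + a) depend on k.
    The partial fraction formula then produces Gamma(a) / Gamma(a + m + 1), where a + m + 1 = m +
    \<nu> + 3/2.\<close>
  have diag: "y powr (\<nu> + 1) / Gamma a * (\<Sum>k\<le>m. A k (m - k)) =
      y powr (2 * real m + \<nu> + 1) / (Gamma (real m + 3/2) * Gamma (real m + \<nu> + 3/2))" for m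
  proof -
    have "(\<Sum>k\<le>m. A k (m - k)) =
        (\<Sum>k\<le>m. y ^ (2 * m) / (fact m * Gamma (real m + 3/2)) *
          ((-1) ^ k * real (m choose k) / (real k + a)))"
      by (intro sum.cong) (auto simp: A_def binomial_fact mult_ac)
    also have "\<dots> = y ^ (2 * m) / Gamma (real m + 3/2) / pochhammer a (Suc m)"
      unfolding sum_distrib_left[symmetric] sum_binomial_reciprocal[OF a] by simp
    also have "pochhammer a (Suc m) = Gamma (real m + \<nu> + 3/2) / Gamma a"
      using pochhammer_Gamma[OF a, of "Suc m"] by (simp add: a_def add_ac)
    finally have "y powr (\<nu> + 1) / Gamma a * (\<Sum>k\<le>m. A k (m - k)) =
        y powr (\<nu> + 1) * y ^ (2 * m) / (Gamma (real m + 3/2) * Gamma (real m + \<nu> + 3/2))"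
      using a by (simp add: Gamma_eq_zero_iff)
    then show ?thesis using pw[of "2 * m"] by simp
  qed
  have "y powr (\<nu> + 1) / Gamma a * S = struve_L \<nu> x"
    using sums_mult[OF S(2), of "y powr (\<nu> + 1) / Gamma a"]
    unfolding diag struve_L_def y_def[symmetric] by (rule sums_unique)
  with sums_mult[OF S(1), of "y powr (\<nu> + 1) / Gamma a"]
  have "(\<lambda>k. y powr (\<nu> + 1) / Gamma a * (\<Sum>j. A k j)) sums struve_L \<nu> x"
    by simp
  then show ?thesis
    unfolding row unfolding y_def a_def .
qed

subsection \<open>Dependence of the Bessel function on its order\<close>

text \<open>The quotient is the Gamma factor of the n-th term of Gamma(u + 1) I_{u + 1/2}(x), so the
  dependence on u is governed by a difference of Digamma values.\<close>

lemma Gamma_quotient_has_derivative: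
  assumes "u \<ge> 0"
  shows "((\<lambda>u. Gamma (u + 1) / Gamma (u + real n + 3/2)) has_real_derivative
     Gamma (u + 1) / Gamma (u + real n + 3/2) * (Digamma (u + 1) - Digamma (u + real n + 3/2))) (at u)"
proof -
  have "Gamma (u + real n + 3/2) > 0" "u + 1 \<notin> \<int>\<^sub>\<le>\<^sub>0" "u + real n + 3/2 \<notin> \<int>\<^sub>\<le>\<^sub>0"
    using assms nonpos_Ints_nonpos[of "u+1"] nonpos_Ints_nonpos[of "u + real n + 3/2"]
    by (auto intro!: Gamma_real_pos)
  then show ?thesis
    by (auto intro!: derivative_eq_intros simp: field_simps)
qed

text \<open>Digamma increases on the positive axis, so n + 3/2 may be raised to n + 2; the
  recurrence then yields n + 1 reciprocals, each at most 1. The first bound controls signs, the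
  second the growth in n of the differentiated terms.\<close>

lemma Digamma_diff_bounds:
  assumes "u \<ge> (0::real)"
  shows "Digamma (u + 1) \<le> Digamma (u + real n + 3/2)"
    and "Digamma (u + real n + 3/2) - Digamma (u + 1) \<le> real (Suc n)"
proof -
  show "Digamma (u + 1) \<le> Digamma (u + real n + 3/2)"
    using assms by (intro Digamma_real_mono) auto
  have "Digamma (u + real n + 3/2) \<le> Digamma (u + 1 + real (Suc n))"
    using assms by (intro Digamma_real_mono) auto
  also have "\<dots> = Digamma (u + 1) + (\<Sum>k<Suc n. 1 / (u + 1 + real k))"
    using assms by (subst Polygamma_plus_of_nat) auto
  also have "(\<Sum>k<Suc n. 1 / (u + 1 + real k)) \<le> (\<Sum>k<Suc n. 1)"
    using assms by (intro sum_mono) auto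
  finally show "Digamma (u + real n + 3/2) - Digamma (u + 1) \<le> real (Suc n)"
    by simp
qed

lemma Gamma_quotient_pos:
  assumes "u \<ge> 0"
  shows "Gamma (u + 1) / Gamma (u + real n + 3/2) > 0"
  using assms by (intro divide_pos_pos Gamma_real_pos) auto

text \<open>By the sign of the Digamma difference the quotient decreases in u, so it is largest at u
  = 0, where it equals 1 / Gamma(n + 3/2).\<close>

lemma Gamma_quotient_le:
  assumes "u \<ge> 0"
  shows "Gamma (u + 1) / Gamma (u + real n + 3/2) \<le> 1 / Gamma (3/2)"
proof -
  have "Gamma (u + 1) / Gamma (u + real n + 3/2) \<le> Gamma (0 + 1) / Gamma (0 + real n + 3/2)"
  proof (rule DERIV_nonpos_imp_nonincreasing[OF assms])
    fix v :: real assume v: "0 \<le> v" "v \<le> u"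
    have "Gamma (v + 1) / Gamma (v + real n + 3/2) * (Digamma (v + 1) - Digamma (v + real n + 3/2)) \<le> 0"
      using Gamma_quotient_pos[OF v(1), of n] Digamma_diff_bounds(1)[OF v(1), of n]
      by (intro mult_nonneg_nonpos) simp_all
    then show "\<exists>D. ((\<lambda>u. Gamma (u + 1) / Gamma (u + real n + 3/2)) has_real_derivative D) (at v) \<and> D \<le> 0"
      using Gamma_quotient_has_derivative[OF v(1)] by blast
  qed
  also have "\<dots> \<le> 1 / Gamma (3/2)"
    using Gamma_ge_three_halves_mono[of "3/2" "real n + 3/2"] 
    by (auto intro!: divide_left_mono mult_pos_pos Gamma_real_pos)
  finally show ?thesis .
qed

definition gamma_bessel :: "real \<Rightarrow> real \<Rightarrow> real" where
  "gamma_bessel x u = Gamma (u + 1) * bessel_I (u + 1/2) x"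

text \<open>The outer factor Gamma(u + 1) is moved into the series, so that each term contains the
  bounded Gamma quotient.\<close>

definition gamma_bessel_term :: "real \<Rightarrow> nat \<Rightarrow> real \<Rightarrow> real" where
  "gamma_bessel_term x n u =
     (x / 2) powr (2 * real n + (u + 1/2)) * (Gamma (u + 1) / Gamma (u + real n + 3/2)) / fact n"

definition gamma_bessel_term_deriv :: "real \<Rightarrow> nat \<Rightarrow> real \<Rightarrow> real" where
  "gamma_bessel_term_deriv x n u =
     gamma_bessel_term x n u * (ln (x / 2) + (Digamma (u + 1) - Digamma (u + real n + 3/2)))"

context
  fixes x :: real
  assumes x: "0 < x" "x < 2"
begin

lemma gamma_bessel_sums:
  assumes "u \<ge> 0"
  shows "(\<lambda>n. gamma_bessel_term x n u) sums gamma_bessel x u"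
proof -
  have "(\<lambda>n. (x / 2) powr (2 * real n + (u + 1/2)) / (Gamma (real n + (u + 1/2) + 1) * fact n))
      sums bessel_I (u + 1/2) x"
    unfolding bessel_I_def using x assms by (intro summable_sums summable_bessel_I) auto
  from sums_mult[OF this, of "Gamma (u + 1)"] show ?thesis
    unfolding gamma_bessel_def
    by (rule back_subst[where P = "\<lambda>f. f sums _"])
       (auto simp: gamma_bessel_term_def fun_eq_iff add_ac mult_ac)
qed

lemma gamma_bessel_term_nonneg: "u \<ge> 0 \<Longrightarrow> gamma_bessel_term x n u \<ge> 0"
  using Gamma_quotient_pos[of u n] unfolding gamma_bessel_term_def by simp

text \<open>The surplus factor (x/2)^(1/2) is at most 1 since x < 2. The bound separates the decay
  in u from an exponential series in n.\<close>

lemma gamma_bessel_term_le: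
  assumes "u \<ge> 0"
  shows "gamma_bessel_term x n u \<le> (x/2) powr u * ((x/2) ^ 2) ^ n / (fact n * Gamma (3/2))"
proof -
  have "(x / 2) powr (2 * real n + (u + 1/2)) = (x/2) powr (1/2) * ((x/2) powr u * (x/2) powr (real (2 * n)))"
    by (simp add: powr_add[symmetric] add_ac)
  also have "(x / 2) powr (real (2 * n)) = ((x/2) ^ 2) ^ n"
    using x by (subst powr_realpow) (simp_all add: power_mult)
  also have "(x/2) powr (1/2) * ((x/2) powr u * ((x/2) ^ 2) ^ n) \<le> 1 * ((x/2) powr u * ((x/2) ^ 2) ^ n)"
    using x by (intro mult_right_mono powr_le1) auto
  finally have 1: "(x / 2) powr (2 * real n + (u + 1/2)) \<le> (x/2) powr u * ((x/2) ^ 2) ^ n"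
    by simp
  have "gamma_bessel_term x n u \<le> ((x/2) powr u * ((x/2) ^ 2) ^ n) * (1 / Gamma (3/2)) / fact n"
    unfolding gamma_bessel_term_def
    using 1 Gamma_quotient_le[OF assms] Gamma_quotient_pos[OF assms, of n]
    by (intro divide_right_mono mult_mono) auto
  then show ?thesis by (simp add: mult_ac)
qed

text \<open>Summing the termwise bounds gives a constant times (x/2)^u, which tends to 0 because x/2
  < 1.\<close>

lemma gamma_bessel_tendsto_0: "(gamma_bessel x \<longlongrightarrow> 0) at_top"
proof (rule tendsto_sandwich)
  define E where "E = (\<Sum>n. inverse (fact n) * ((x/2) ^ 2) ^ n) / Gamma (3/2)"
  have "gamma_bessel x u \<le> (x/2) powr u * E" if "u \<ge> 0" for u
  proof (rule sums_le[OF _ gamma_bessel_sums[OF that]])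
    have "(\<lambda>n. (x/2) powr u * (inverse (fact n) * ((x/2) ^ 2) ^ n / Gamma (3/2))) sums ((x/2) powr u * E)"
      unfolding E_def by (intro sums_mult sums_divide summable_sums summable_exp)
    then show "(\<lambda>n. (x/2) powr u * ((x/2) ^ 2) ^ n / (fact n * Gamma (3/2))) sums ((x/2) powr u * E)"
      by (simp add: field_simps)
  qed (rule gamma_bessel_term_le[OF that])
  then show "\<forall>\<^sub>F u in at_top. gamma_bessel x u \<le> (x/2) powr u * E"
    by (intro eventually_at_top_linorderI)
  have "0 \<le> gamma_bessel x u" if "u \<ge> 0" for u
    using sums_le[OF gamma_bessel_term_nonneg[OF that] sums_zero gamma_bessel_sums[OF that]] .
  then show "\<forall>\<^sub>F u in at_top. 0 \<le> gamma_bessel x u"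
    by (intro eventually_at_top_linorderI)
  have "((\<lambda>u. exp (ln (x/2) * u)) \<longlongrightarrow> 0) at_top"
    using x by (intro filterlim_compose[OF exp_at_bot] filterlim_tendsto_neg_mult_at_bot[OF tendsto_const _ filterlim_ident]) auto
  then have "((\<lambda>u. (x/2) powr u * E) \<longlongrightarrow> 0 * E) at_top"
    using x by (intro tendsto_mult tendsto_const) (simp add: powr_def mult_ac)
  then show "((\<lambda>u. (x/2) powr u * E) \<longlongrightarrow> 0) at_top" by simp
qed (rule tendsto_const)

lemma gamma_bessel_term_has_derivative:
  assumes "u \<ge> 0"
  shows "(gamma_bessel_term x n has_real_derivative gamma_bessel_term_deriv x n u) (at u)"
proof -
  have "((\<lambda>u. (x / 2) powr (2 * real n + (u + 1/2))) has_real_derivative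
      (x / 2) powr (2 * real n + (u + 1/2)) * ln (x / 2)) (at u)"
    using x by (auto intro!: derivative_eq_intros)
  from DERIV_cdivide[OF DERIV_mult[OF this Gamma_quotient_has_derivative[OF assms, of n]], of "fact n"]
  show ?thesis
    unfolding gamma_bessel_term_def[abs_def] gamma_bessel_term_deriv_def
    by (rule DERIV_cong) (simp add: distrib_left add_divide_distrib mult_ac)
qed

text \<open>The Digamma difference costs a factor of order n + 1, at most 2^n, which the exponential
  series absorbs. The bound is free of u, as the Weierstrass test requires.\<close>

lemma gamma_bessel_term_deriv_bound:
  assumes "u \<ge> 0"
  shows "norm (gamma_bessel_term_deriv x n u) \<le>
    (1 - ln (x/2)) / Gamma (3/2) * (inverse (fact n) * (2 * (x/2) ^ 2) ^ n)"
proof -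
  have l: "ln (x/2) < 0" using x by (simp add: ln_less_zero_iff)
  have "\<bar>ln (x / 2) + (Digamma (u + 1) - Digamma (u + real n + 3/2))\<bar> \<le> - ln (x/2) + real (Suc n)"
    using Digamma_diff_bounds[OF assms, of n] l by linarith
  also have "\<dots> \<le> (1 - ln (x/2)) * real (Suc n)"
    using l mult_right_mono[of 1 "real (Suc n)" "- ln (x/2)"] by (simp add: algebra_simps)
  also have "\<dots> \<le> (1 - ln (x/2)) * 2 ^ n"
    using l Suc_leI[OF less_exp[of n]] by (intro mult_left_mono) (simp_all del: of_nat_Suc add: of_nat_le_iff[of _ "2^n", where 'a = real, simplified])
  finally have 1: "\<bar>ln (x / 2) + (Digamma (u + 1) - Digamma (u + real n + 3/2))\<bar> \<le> (1 - ln (x/2)) * 2 ^ n" .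
  have "gamma_bessel_term x n u \<le> (x/2) powr u * (((x/2) ^ 2) ^ n / (fact n * Gamma (3/2)))"
    using gamma_bessel_term_le[OF assms] by simp
  also have "\<dots> \<le> 1 * (((x/2) ^ 2) ^ n / (fact n * Gamma (3/2)))"
    using x assms by (intro mult_right_mono powr_le1 divide_nonneg_nonneg mult_nonneg_nonneg less_imp_le[OF Gamma_real_pos]) auto
  finally have 2: "gamma_bessel_term x n u \<le> ((x/2) ^ 2) ^ n / (fact n * Gamma (3/2))" by simp
  have "norm (gamma_bessel_term_deriv x n u) \<le>
      ((x/2) ^ 2) ^ n / (fact n * Gamma (3/2)) * ((1 - ln (x/2)) * 2 ^ n)"
    unfolding gamma_bessel_term_deriv_def norm_mult
    using 1 2 gamma_bessel_term_nonneg[OF assms, of n] by (intro mult_mono) auto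
  then show ?thesis
    by (simp only: divide_inverse inverse_mult_distrib mult_ac power_mult_distrib)
qed

lemma gamma_bessel_deriv_limit:
  "uniform_limit {0..} (\<lambda>n u. \<Sum>i<n. gamma_bessel_term_deriv x i u)
     (\<lambda>u. \<Sum>i. gamma_bessel_term_deriv x i u) sequentially"
  by (rule Weierstrass_m_test[OF gamma_bessel_term_deriv_bound summable_mult[OF summable_exp]]) simp

text \<open>The series is differentiated term by term on [0, \<infinity>). Taking u > 0 puts u in
  the interior, and near u the series represents \<open>gamma_bessel x\<close>.\<close>

lemma gamma_bessel_has_derivative:
  assumes "u > 0"
  shows "(gamma_bessel x has_real_derivative (\<Sum>n. gamma_bessel_term_deriv x n u)) (at u)"
proof -
  have "((\<lambda>u. \<Sum>n. gamma_bessel_term x n u) has_real_derivative (\<Sum>n. gamma_bessel_term_deriv x n u)) (at u)"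
  proof (rule has_field_derivative_series'(2)[where S = "{0..}"])
    show "uniformly_convergent_on {0..} (\<lambda>n u. \<Sum>i<n. gamma_bessel_term_deriv x i u)"
      using gamma_bessel_deriv_limit by (auto simp: uniformly_convergent_on_def)
    show "summable (\<lambda>n. gamma_bessel_term x n 0)"
      using gamma_bessel_sums[of 0] by (simp add: sums_iff)
  qed (use assms in \<open>auto intro!: has_field_derivative_at_within gamma_bessel_term_has_derivative simp: interior_real_atLeast\<close>)
  then show ?thesis
  proof (rule DERIV_cong_ev[THEN iffD1, rotated -1])
    show "\<forall>\<^sub>F v in nhds u. (\<Sum>n. gamma_bessel_term x n v) = gamma_bessel x v"
      using eventually_nhds_in_open[of "{0<..}" u] assms
      by (auto elim!: eventually_mono simp: sums_unique[OF gamma_bessel_sums])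
  qed auto
qed

lemma continuous_on_gamma_bessel_deriv:
  "continuous_on {0..} (\<lambda>u. \<Sum>n. gamma_bessel_term_deriv x n u)"
proof (rule uniform_limit_theorem[OF _ gamma_bessel_deriv_limit])
  have "continuous_on {0..} (gamma_bessel_term x i)" for i
    by (rule DERIV_continuous_on)
       (auto intro: has_field_derivative_at_within gamma_bessel_term_has_derivative)
  moreover have "continuous_on {0..} (\<lambda>u::real. Digamma (u + c))" if "c > 0" for c
    using that
    by (intro continuous_at_imp_continuous_on ballI isCont_Polygamma continuous_intros)
       (auto dest: nonpos_Ints_nonpos)
  from this[of 1] this[of "real i + 3/2" for i]
  have "continuous_on {0..} (\<lambda>u::real. Digamma (u + 1))"
    "continuous_on {0..} (\<lambda>u::real. Digamma (u + real i + 3/2))" for i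
    by (simp_all add: add.assoc)
  ultimately have "continuous_on {0..} (gamma_bessel_term_deriv x i)" for i
    unfolding gamma_bessel_term_deriv_def[abs_def]
    by (intro continuous_on_mult continuous_on_add continuous_on_diff continuous_on_const)
  then show "\<forall>\<^sub>F n in sequentially. continuous_on {0..} (\<lambda>u. \<Sum>i<n. gamma_bessel_term_deriv x i u)"
    by (intro always_eventually allI continuous_on_sum) auto
qed auto

text \<open>Both ln(x/2) and the Digamma difference are nonpositive, hence so is every term. The
  sign is what makes the derivative integrable up to infinity.\<close>

lemma gamma_bessel_deriv_nonpos:
  assumes "u \<ge> 0"
  shows "(\<Sum>n. gamma_bessel_term_deriv x n u) \<le> 0"
proof -
  have "ln (x/2) < 0" using x by (simp add: ln_less_zero_iff)
  then have "gamma_bessel_term_deriv x n u \<le> 0" for n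
    unfolding gamma_bessel_term_deriv_def
    using Digamma_diff_bounds(1)[OF assms, of n] gamma_bessel_term_nonneg[OF assms, of n]
    by (intro mult_nonneg_nonpos) auto
  moreover have "summable (\<lambda>n. gamma_bessel_term_deriv x n u)"
    using assms
    by (intro summable_comparison_test'[OF _ gamma_bessel_term_deriv_bound] summable_mult summable_exp)
  ultimately show ?thesis
    using suminf_le[of "\<lambda>n. gamma_bessel_term_deriv x n u" "\<lambda>_. 0"] by simp
qed

lemma deriv_gamma_bessel:
  "u > 0 \<Longrightarrow> deriv (gamma_bessel x) u = (\<Sum>n. gamma_bessel_term_deriv x n u)"
  by (rule DERIV_imp_deriv[OF gamma_bessel_has_derivative])

lemma continuous_on_deriv_gamma_bessel: "continuous_on {0<..} (deriv (gamma_bessel x))"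
proof -
  have "continuous_on {0<..} (\<lambda>u. \<Sum>n. gamma_bessel_term_deriv x n u)"
    by (rule continuous_on_subset[OF continuous_on_gamma_bessel_deriv]) auto
  then show ?thesis
    by (rule continuous_on_eq) (simp add: deriv_gamma_bessel)
qed

text \<open>The negated derivative is nonnegative and its antiderivative has finite limits at 1 and
  at infinity, so the fundamental theorem for nonnegative integrands yields integrability
  itself.\<close>

lemma set_integrable_deriv_gamma_bessel:
  "set_integrable lborel {1<..} (deriv (gamma_bessel x))"
proof -
  have "set_integrable lborel (einterval 1 \<infinity>) (\<lambda>u. - deriv (gamma_bessel x) u)"
  proof (rule interval_integral_FTC_nonneg(1))
    show "((\<lambda>u. - gamma_bessel x u) has_real_derivative - deriv (gamma_bessel x) u) (at u)"
      if "1 < ereal u" "ereal u < \<infinity>" for u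
      using that gamma_bessel_has_derivative[of u] deriv_gamma_bessel[of u]
      by (auto intro!: derivative_eq_intros simp: one_ereal_def)
    show "isCont (\<lambda>u. - deriv (gamma_bessel x) u) u" if "1 < ereal u" "ereal u < \<infinity>" for u
      using that continuous_on_deriv_gamma_bessel
      by (intro continuous_minus) (auto simp: continuous_on_eq_continuous_at one_ereal_def)
    show "AE u in lborel. 1 < ereal u \<longrightarrow> ereal u < \<infinity> \<longrightarrow> 0 \<le> - deriv (gamma_bessel x) u"
      using gamma_bessel_deriv_nonpos by (auto simp: one_ereal_def deriv_gamma_bessel)
    have "isCont (gamma_bessel x) 1"
      using gamma_bessel_has_derivative[of 1] by (auto intro: DERIV_isCont)
    then have "((\<lambda>u. - gamma_bessel x u) \<longlongrightarrow> - gamma_bessel x 1) (at_right 1)"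
      by (intro tendsto_minus) (simp add: isCont_def filterlim_at_split)
    then show "(((\<lambda>u. - gamma_bessel x u) \<circ> real_of_ereal) \<longlongrightarrow> - gamma_bessel x 1) (at_right 1)"
      by (simp add: one_ereal_def ereal_tendsto_simps)
    show "(((\<lambda>u. - gamma_bessel x u) \<circ> real_of_ereal) \<longlongrightarrow> - 0) (at_left \<infinity>)"
      by (subst ereal_tendsto_simps) (intro tendsto_minus gamma_bessel_tendsto_0)
  qed auto
  then show ?thesis
    by (simp add: set_integrable_def einterval_def one_ereal_def greaterThan_def)
qed

end

subsection \<open>The inner integral\<close>

text \<open>Integrability and value sit in one predicate, so that a single induction or gluing step
  carries both.\<close>

definition has_set_integral :: "(real \<Rightarrow> complex) \<Rightarrow> complex \<Rightarrow> real set \<Rightarrow> bool" where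
  "has_set_integral f v A \<longleftrightarrow> has_bochner_integral lborel (\<lambda>s. indicat_real A s *\<^sub>R f s) v"

lemma has_set_integral_iff:
  "has_set_integral f v A \<longleftrightarrow> set_integrable lborel A f \<and> (LINT s:A|lborel. f s) = v"
  by (simp add: has_set_integral_def has_bochner_integral_iff set_integrable_def set_lebesgue_integral_def)

lemma has_set_integral_cong_except:
  assumes "has_set_integral f v A" "countable X"
    and "\<And>s. s \<notin> X \<Longrightarrow> indicat_real A s *\<^sub>R f s = indicat_real B s *\<^sub>R g s"
  shows "has_set_integral g v B"
  using assms(1) unfolding has_set_integral_def
  by (rule has_bochner_integral_discrete_difference[OF assms(2), THEN iffD1, rotated -1])
     (use assms(3) in auto)

lemma has_set_integral_Un:
  assumes "has_set_integral f v A" "has_set_integral f w B"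
    and "countable X" "\<And>s. s \<notin> X \<Longrightarrow> indicat_real C s = indicat_real A s + indicat_real B s"
  shows "has_set_integral f (v + w) C"
  unfolding has_set_integral_def
proof (rule has_bochner_integral_discrete_difference[OF assms(3), THEN iffD1, rotated -1])
  show "has_bochner_integral lborel (\<lambda>s. indicat_real A s *\<^sub>R f s + indicat_real B s *\<^sub>R f s) (v + w)"
    using assms(1,2) unfolding has_set_integral_def by (rule has_bochner_integral_add)
qed (use assms(4) in \<open>auto simp: scaleR_add_left\<close>)

lemma has_set_integral_join:
  assumes "has_set_integral f v {a<..<b}" "has_set_integral f w {b<..<c}" "a \<le> b" "b \<le> c"
  shows "has_set_integral f (v + w) {a<..<c}"
  using assms by (intro has_set_integral_Un[where X = "{b}", OF assms(1,2)]) (auto simp: indicator_def)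

text \<open>On \<open>[k, k + 1]\<close> the expression \<open>f(s) + (s - k) f'(s)\<close> is the derivative of \<open>(s - k) f(s)\<close>.\<close>

lemma has_set_integral_euler_op:
  fixes f f' :: "real \<Rightarrow> complex" and k :: int
  assumes "of_int k \<le> a" "a \<le> b" "b \<le> of_int k + 1"
    and f: "\<And>s. a \<le> s \<Longrightarrow> s \<le> b \<Longrightarrow> (f has_vector_derivative f' s) (at s)"
    and f': "continuous_on {a..b} f'"
  shows "has_set_integral (euler_op f) ((b - of_int k) *\<^sub>R f b - (a - of_int k) *\<^sub>R f a) {a<..<b}"
\<comment> \<open>At s = k + 1 the fractional part drops to 0, so \<open>euler_op f\<close> is
  compared with the derivative of (s - k) f(s) only away from the end points.\<close>
proof (rule has_set_integral_cong_except[where X = "{a, b}"])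
  have "continuous_on {a..b} f"
    using f by (intro continuous_at_imp_continuous_on ballI)
      (auto intro: has_vector_derivative_continuous)
  then show "has_set_integral (\<lambda>s. (s - of_int k) *\<^sub>R f' s + 1 *\<^sub>R f s)
      ((b - of_int k) *\<^sub>R f b - (a - of_int k) *\<^sub>R f a) {a..b}"
    unfolding has_set_integral_def using assms
    by (intro has_bochner_integral_FTC_Icc continuous_intros has_vector_derivative_scaleR
          has_vector_derivative_at_within[OF f])
       (auto intro!: derivative_eq_intros)
  fix s assume s: "s \<notin> {a, b}"
  show "indicat_real {a..b} s *\<^sub>R ((s - of_int k) *\<^sub>R f' s + 1 *\<^sub>R f s) =
      indicat_real {a<..<b} s *\<^sub>R euler_op f s"
  proof (cases "s \<in> {a<..<b}")
    case True
    then have "\<lfloor>s\<rfloor> = k" using assms by (intro floor_unique) auto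
    moreover have "vector_derivative f (at s) = f' s"
      using f[of s] True by (intro vector_derivative_at) auto
    ultimately show ?thesis
      using True by (simp add: euler_op_def frac_def scaleR_conv_of_real)
  qed (use s in auto)
qed auto

text \<open>On each unit interval the weight s - i is 0 at the left end and 1 at the right end, so
  [i, i + 1] contributes just f(i + 1).\<close>

lemma has_set_integral_euler_op_integers:
  fixes f f' :: "real \<Rightarrow> complex" and m n :: nat
  assumes "m \<le> n"
    and f: "\<And>s. real m \<le> s \<Longrightarrow> s \<le> real n \<Longrightarrow> (f has_vector_derivative f' s) (at s)"
    and f': "continuous_on {real m..real n} f'"
  shows "has_set_integral (euler_op f) (\<Sum>i\<in>{m<..n}. f (real i)) {real m<..<real n}"
  using assms
proof (induction n rule: dec_induct)
  case base
  then show ?case by (simp add: has_set_integral_def has_bochner_integral_zero)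
next
  case (step n)
  have "has_set_integral (euler_op f)
      ((real (Suc n) - of_int (int n)) *\<^sub>R f (real (Suc n)) - (real n - of_int (int n)) *\<^sub>R f (real n))
      {real n<..<real (Suc n)}"
    using step.prems step.hyps
    by (intro has_set_integral_euler_op[where f' = f'])
       (auto elim: continuous_on_subset)
  moreover have "has_set_integral (euler_op f) (\<Sum>i\<in>{m<..n}. f (real i)) {real m<..<real n}"
    using step.prems by (intro step.IH) (auto elim: continuous_on_subset)
  ultimately have "has_set_integral (euler_op f) ((\<Sum>i\<in>{m<..n}. f (real i)) + f (real (Suc n)))
      {real m<..<real (Suc n)}"
    using step.hyps by (intro has_set_integral_join[where b = "real n"]) auto
  moreover have "{m<..Suc n} = insert (Suc n) {m<..n}"
    using step.hyps by auto
  ultimately show ?case by (simp add: add.commute)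
qed

text \<open>Both one-sided versions of this limit enter the evaluation at the pole.\<close>

lemma has_vector_derivative_imp_quotient_tendsto:
  fixes w :: "real \<Rightarrow> complex"
  assumes "(w has_vector_derivative D) (at p)"
  shows "((\<lambda>e. (w (p + e) - w p) /\<^sub>R e) \<longlongrightarrow> D) (at 0)"
proof -
  have "((\<lambda>e. norm (w (p + e) - w p - e *\<^sub>R D) / norm e) \<longlongrightarrow> 0) (at 0)"
    using assms unfolding has_vector_derivative_def has_derivative_at by simp
  then have "((\<lambda>e. (w (p + e) - w p) /\<^sub>R e - D) \<longlongrightarrow> 0) (at 0)"
  proof (subst tendsto_norm_zero_iff[symmetric], elim Lim_transform_eventually)
    show "\<forall>\<^sub>F e in at 0. norm (w (p + e) - w p - e *\<^sub>R D) / norm e = norm ((w (p + e) - w p) /\<^sub>R e - D)"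
      unfolding eventually_at_filter
    proof (intro always_eventually allI impI)
      fix e :: real assume "e \<noteq> 0"
      then have "(w (p + e) - w p) /\<^sub>R e - D = (w (p + e) - w p - e *\<^sub>R D) /\<^sub>R e"
        by (simp add: scaleR_diff_right)
      then show "norm (w (p + e) - w p - e *\<^sub>R D) / norm e = norm ((w (p + e) - w p) /\<^sub>R e - D)"
        by (simp add: divide_inverse mult.commute)
    qed
  qed
  then show ?thesis by (simp add: Lim_null[symmetric])
qed

lemma has_finite_part_integral_euler_op_regular:
  fixes f f' :: "real \<Rightarrow> complex"
  assumes "\<And>s. 0 \<le> s \<Longrightarrow> s \<le> real n \<Longrightarrow> (f has_vector_derivative f' s) (at s)"
    and "continuous_on {0..real n} f'"
  shows "set_integrable lborel {0<..<real n} (euler_op f)"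
    and "has_finite_part_integral (euler_op f) 0 (real n) (\<Sum>i\<in>{0<..n}. f (real i))"
  using has_set_integral_euler_op_integers[of 0 n f f'] assms
    has_finite_part_integral_LINT[of 0 "real n" "euler_op f"]
  by (auto simp: has_set_integral_iff)

section \<open>A simple pole of f strictly between two integers\<close>

context
  fixes h h' f :: "real \<Rightarrow> complex" and p :: real and n k :: nat
  assumes h: "\<And>s. 0 \<le> s \<Longrightarrow> (h has_vector_derivative h' s) (at s)"
    and h': "continuous_on {0..} h'"
    and hp: "h p \<noteq> 0"
    and p: "real k < p" "p < real (Suc k)" "k < n"
    and f: "f = (\<lambda>s. h s /\<^sub>R (s - p))"
begin

private definition f' :: "real \<Rightarrow> complex" where
  "f' s = inverse (s - p) *\<^sub>R h' s + (- inverse ((s - p)^2)) *\<^sub>R h s"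

private lemma f_has_vector_derivative:
  assumes "0 \<le> s" "s \<noteq> p"
  shows "(f has_vector_derivative f' s) (at s)"
  unfolding f f'_def using assms
  by (intro has_vector_derivative_scaleR h)
     (auto intro!: derivative_eq_intros simp: power2_eq_square)

private lemma continuous_on_f':
  assumes "A \<subseteq> {0..} - {p}"
  shows "continuous_on A f'"
proof -
  have "continuous_on {0..} h"
    using h by (intro continuous_at_imp_continuous_on ballI)
      (auto intro: has_vector_derivative_continuous)
  then have "continuous_on A h" "continuous_on A h'"
    using h' assms by (auto elim!: continuous_on_subset)
  then show ?thesis
    unfolding f'_def using assms by (auto intro!: continuous_intros)
qed

text \<open>The unit intervals up to k contribute values of f. The truncated interval contributes
  only its right boundary term, since the weight s - k vanishes at k.\<close>

private lemma euler_op_left: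
  assumes "0 < e" "e < p - real k"
  shows "has_set_integral (euler_op f)
    ((\<Sum>i\<in>{0<..k}. f (real i)) + (p - e - real k) *\<^sub>R f (p - e)) {0<..<p - e}"
proof -
  have "has_set_integral (euler_op f) (\<Sum>i\<in>{0<..k}. f (real i)) {real 0<..<real k}"
    using p by (intro has_set_integral_euler_op_integers[where f' = f']
       f_has_vector_derivative continuous_on_f') auto
  moreover have "has_set_integral (euler_op f)
      ((p - e - of_int (int k)) *\<^sub>R f (p - e) - (real k - of_int (int k)) *\<^sub>R f (real k)) {real k<..<p - e}"
    using p assms by (intro has_set_integral_euler_op[where f' = f']
       f_has_vector_derivative continuous_on_f') auto
  ultimately show ?thesis
    using p assms has_set_integral_join[of "euler_op f" _ 0 "real k" _ "p - e"] by auto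
qed

text \<open>The weight is 1 at the right end of the truncated interval, which supplies the summand
  f(k + 1) missing from the later unit intervals.\<close>

private lemma euler_op_right:
  assumes "0 < e" "e < real (Suc k) - p"
  shows "has_set_integral (euler_op f)
    ((\<Sum>i\<in>{k<..n}. f (real i)) - (p + e - real k) *\<^sub>R f (p + e)) {p + e<..<real n}"
proof -
  have "has_set_integral (euler_op f) (\<Sum>i\<in>{Suc k<..n}. f (real i)) {real (Suc k)<..<real n}"
    using p by (intro has_set_integral_euler_op_integers[where f' = f']
       f_has_vector_derivative continuous_on_f') auto
  moreover have "has_set_integral (euler_op f)
      ((real (Suc k) - of_int (int k)) *\<^sub>R f (real (Suc k)) - (p + e - of_int (int k)) *\<^sub>R f (p + e))
      {p + e<..<real (Suc k)}"
    using p assms by (intro has_set_integral_euler_op[where f' = f']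
       f_has_vector_derivative continuous_on_f') auto
  ultimately have "has_set_integral (euler_op f)
      ((real (Suc k) - of_int (int k)) *\<^sub>R f (real (Suc k)) - (p + e - of_int (int k)) *\<^sub>R f (p + e)
        + (\<Sum>i\<in>{Suc k<..n}. f (real i))) {p + e<..<real n}"
    using p assms by (intro has_set_integral_join[where b = "real (Suc k)"]) auto
  moreover have "{k<..n} = insert (Suc k) {Suc k<..n}"
    using p by auto
  ultimately show ?thesis by (simp add: algebra_simps)
qed

private definition w :: "real \<Rightarrow> complex" where
  "w s = (s - real k) *\<^sub>R h s"

private lemma w_p: "w p \<noteq> 0"
  using hp p by (simp add: w_def)

private lemma w_has_vector_derivative:
  "(w has_vector_derivative ((p - real k) *\<^sub>R h' p + 1 *\<^sub>R h p)) (at p)"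
  unfolding w_def using p
  by (intro has_vector_derivative_scaleR h) (auto intro!: derivative_eq_intros)

text \<open>Near \<open>p\<close> the antiderivative \<open>(s - k) f(s) = w(s) / (s - p)\<close> is unbounded.\<close>

private lemma not_integrable_at_pole:
  assumes "r > 0"
  shows "\<not> set_integrable lborel ({0<..<real n} \<inter> ball p r) (euler_op f)"
proof
  assume int: "set_integrable lborel ({0<..<real n} \<inter> ball p r) (euler_op f)"
  define d where "d = min r (real (Suc k) - p) / 2"
  have d: "0 < d" "d < r" "d < real (Suc k) - p" "p + d < real (Suc k)"
    using p assms unfolding d_def min_def by (auto simp: field_simps)
  have "real (Suc k) \<le> real n" using p by simp
  then have sub: "{p<..<p + d} \<subseteq> {0<..<real n} \<inter> ball p r"
    using d p by (auto simp: dist_real_def)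
  have int': "set_integrable lborel {p<..<p + d} (euler_op f)"
    by (rule set_integrable_subset[OF int _ sub]) auto
  \<comment> \<open>The antiderivative at p + e differs from its value at p + d by at most
    \<open>M\<close> in norm. Hence w(p + e) / e would stay bounded by \<open>C\<close> as e tends
    to 0, forcing w(p) = 0.\<close>
  define M where "M = (LINT s:{p<..<p + d}|lborel. norm (euler_op f s))"
  define C where "C = M + norm ((p + d - real k) *\<^sub>R f (p + d))"
  have bound: "norm (w (p + e)) \<le> e * C" if e: "0 < e" "e < d" for e
  proof -
    have "has_set_integral (euler_op f)
      ((p + d - of_int (int k)) *\<^sub>R f (p + d) - (p + e - of_int (int k)) *\<^sub>R f (p + e)) {p + e<..<p + d}"
      using p d e by (intro has_set_integral_euler_op[where f' = f']
         f_has_vector_derivative continuous_on_f') auto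
    then have I: "set_integrable lborel {p + e<..<p + d} (euler_op f)"
      "(LINT s:{p + e<..<p + d}|lborel. euler_op f s) = (p + d - real k) *\<^sub>R f (p + d) - (p + e - real k) *\<^sub>R f (p + e)"
      by (simp_all add: has_set_integral_iff)
    have "norm (LINT s:{p + e<..<p + d}|lborel. euler_op f s) \<le> (LINT s:{p + e<..<p + d}|lborel. norm (euler_op f s))"
      by (rule set_integral_norm_bound[OF I(1)])
    also have "\<dots> \<le> M"
      unfolding M_def set_lebesgue_integral_def
      using set_integrable_norm[OF I(1)] set_integrable_norm[OF int'] e
      by (intro integral_mono) (auto simp: set_integrable_def indicator_def)
    finally have "norm ((p + e - real k) *\<^sub>R f (p + e)) \<le> C"
      unfolding I(2) C_def
      using norm_triangle_ineq2[of "(p + e - real k) *\<^sub>R f (p + e)" "(p + d - real k) *\<^sub>R f (p + d)"]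
      by (simp add: norm_minus_commute)
    moreover have "(p + e - real k) *\<^sub>R f (p + e) = w (p + e) /\<^sub>R e"
      by (simp add: w_def f)
    ultimately show ?thesis
      using e by (simp add: field_simps)
  qed
  have "isCont w p"
    using w_has_vector_derivative by (rule has_vector_derivative_continuous)
  then have "((\<lambda>e. w (p + e)) \<longlongrightarrow> w p) (at 0)"
    by (simp add: isCont_iff)
  then have "((\<lambda>e. norm (w (p + e))) \<longlongrightarrow> norm (w p)) (at_right 0)"
    by (intro tendsto_norm) (rule filterlim_mono[OF _ order_refl at_le], auto)
  moreover have "((\<lambda>e. e * C) \<longlongrightarrow> 0 * C) (at_right 0)"
    by (intro tendsto_intros)
  moreover have "\<forall>\<^sub>F e in at_right 0. norm (w (p + e)) \<le> e * C"
    using eventually_at_right_real[OF d(1)] by eventually_elim (auto intro: bound)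
  ultimately have "norm (w p) \<le> 0 * C"
    by (intro tendsto_le[OF trivial_limit_at_right_real])
  with w_p show False by simp
qed

private lemma singular_points_euler_op: "singular_points (euler_op f) 0 (real n) = {p}"
proof (rule set_eqI)
  have n: "real (Suc k) \<le> real n" using p by simp
  fix r
  show "r \<in> singular_points (euler_op f) 0 (real n) \<longleftrightarrow> r \<in> {p}"
  proof (cases "r = p")
    case True
    then show ?thesis
      using p n not_integrable_at_pole by (auto simp: singular_points_def)
  next
    case False
    then consider "r < p" | "r > p" by linarith
    then have "\<exists>d>0. set_integrable lborel ({0<..<real n} \<inter> ball r d) (euler_op f)"
    proof cases
      case 1
      \<comment> \<open>The ball of radius (p - r) / 2 about r ends at distance (p - r) / 2 from p,
        and \<open>e\<close> is no larger, so the ball stays left of p - e.\<close>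
      define e where "e = min (p - r) (p - real k) / 2"
      have e: "0 < e" "e < p - real k" "e \<le> (p - r) / 2"
        using 1 p by (auto simp: e_def min_def field_simps)
      have "set_integrable lborel ({0<..<real n} \<inter> ball r ((p - r) / 2)) (euler_op f)"
      proof (rule set_integrable_subset)
        show "set_integrable lborel {0<..<p - e} (euler_op f)"
          using euler_op_left[OF e(1,2)] by (simp add: has_set_integral_iff)
      qed (use e 1 in \<open>auto simp: dist_real_def abs_real_def field_simps split: if_splits\<close>)
      then show ?thesis using 1 by (intro exI[of _ "(p - r) / 2"]) auto
    next
      case 2
      define e where "e = min (r - p) (real (Suc k) - p) / 2"
      have e: "0 < e" "e < real (Suc k) - p" "e \<le> (r - p) / 2"
        using 2 p by (auto simp: e_def min_def field_simps)
      have "set_integrable lborel ({0<..<real n} \<inter> ball r ((r - p) / 2)) (euler_op f)"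
      proof (rule set_integrable_subset)
        show "set_integrable lborel {p + e<..<real n} (euler_op f)"
          using euler_op_right[OF e(1,2)] by (simp add: has_set_integral_iff)
      qed (use e 2 in \<open>auto simp: dist_real_def abs_real_def field_simps split: if_splits\<close>)
      then show ?thesis using 2 by (intro exI[of _ "(r - p) / 2"]) auto
    qed
    with False show ?thesis by (auto simp: singular_points_def)
  qed
qed

text \<open>The boundary terms of the two pieces add up to - (w(p + e) + w(p - e)) / e. The
  first-order terms of w at p cancel, leaving - 2 w(p) / e, which is exactly the polynomial in 1 / e
  to discard, and an error tending to 0.\<close>

lemma has_finite_part_integral_euler_op_pole:
  "has_finite_part_integral (euler_op f) 0 (real n) (\<Sum>i\<in>{0<..n}. f (real i))"
proof -
  define d where "d = min (p - real k) (real (Suc k) - p)"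
  define W where "W = (p - real k) *\<^sub>R h' p + 1 *\<^sub>R h p"
  have d: "d > 0" using p by (simp add: d_def)
  have n: "real (Suc k) \<le> real n" using p by simp
  have cut: "has_set_integral (euler_op f)
      ((\<Sum>i\<in>{0<..n}. f (real i)) - (w (p + e) + w (p - e)) /\<^sub>R e)
      (cut_interval (euler_op f) 0 (real n) e)" if e: "0 < e" "e < d" for e
  proof -
    have ek: "e < p - real k" "e < real (Suc k) - p" using e by (auto simp: d_def)
    have "{0<..n} = {0<..k} \<union> {k<..n}" using p by auto
    then have "(\<Sum>i\<in>{0<..n}. f (real i)) = (\<Sum>i\<in>{0<..k}. f (real i)) + (\<Sum>i\<in>{k<..n}. f (real i))"
      by (simp add: sum.union_disjoint)
    moreover have "(p - e - real k) *\<^sub>R f (p - e) = - (w (p - e) /\<^sub>R e)"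
      "(p + e - real k) *\<^sub>R f (p + e) = w (p + e) /\<^sub>R e"
      by (simp_all add: w_def f)
    ultimately have eq: "(\<Sum>i\<in>{0<..n}. f (real i)) - (w (p + e) + w (p - e)) /\<^sub>R e =
      ((\<Sum>i\<in>{0<..k}. f (real i)) + (p - e - real k) *\<^sub>R f (p - e)) +
      ((\<Sum>i\<in>{k<..n}. f (real i)) - (p + e - real k) *\<^sub>R f (p + e))"
      by (simp add: scaleR_add_right)
    show ?thesis
      unfolding eq
    proof (rule has_set_integral_Un[OF euler_op_left[OF e(1) ek(1)] euler_op_right[OF e(1) ek(2)]])
      fix s assume "s \<notin> {p - e, p + e}"
      then show "indicat_real (cut_interval (euler_op f) 0 (real n) e) s =
          indicat_real {0<..<p - e} s + indicat_real {p + e<..<real n} s"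
        using e ek p n
        by (auto simp: cut_interval_def singular_points_euler_op indicator_def dist_real_def)
    qed auto
  qed
  have ev: "\<forall>\<^sub>F e in at_right 0. 0 < e \<and> e < d"
    using eventually_at_right_real[OF d] by simp
  show ?thesis
    unfolding has_finite_part_integral_def
  proof (intro conjI exI)
    show "\<forall>\<^sub>F e in at_right 0. set_integrable lborel (cut_interval (euler_op f) 0 (real n) e) (euler_op f)"
      using ev by eventually_elim (use cut in \<open>simp add: has_set_integral_iff\<close>)
    show "coeff [:0, - 2 * w p:] 0 = 0" by simp
    have t: "((\<lambda>e. (w (p + e) - w p) /\<^sub>R e) \<longlongrightarrow> W) (at 0)"
      unfolding W_def by (rule has_vector_derivative_imp_quotient_tendsto[OF w_has_vector_derivative])
    then have t1: "((\<lambda>e. (w (p + e) - w p) /\<^sub>R e) \<longlongrightarrow> W) (at_right 0)"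
      by (rule filterlim_mono[OF _ order_refl at_le]) auto
    \<comment> \<open>Replacing e by - e gives the left difference quotient the same limit
      \<open>W\<close>, so that the two quotients cancel in the limit.\<close>
    have "filterlim (\<lambda>e::real. - e) (at 0) (at_right 0)"
      by (auto simp: filterlim_at intro!: tendsto_eq_intros simp: eventually_at_filter)
    from filterlim_compose[OF t this]
    have t2: "((\<lambda>e. (w (p - e) - w p) /\<^sub>R (- e)) \<longlongrightarrow> W) (at_right 0)"
      by simp
    have "((\<lambda>e. (\<Sum>i\<in>{0<..n}. f (real i)) - ((w (p + e) - w p) /\<^sub>R e - (w (p - e) - w p) /\<^sub>R (- e)))
        \<longlongrightarrow> (\<Sum>i\<in>{0<..n}. f (real i)) - (W - W)) (at_right 0)"
      by (intro tendsto_diff tendsto_const t1 t2)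
    then have "((\<lambda>e. (\<Sum>i\<in>{0<..n}. f (real i)) - ((w (p + e) - w p) /\<^sub>R e - (w (p - e) - w p) /\<^sub>R (- e)))
        \<longlongrightarrow> (\<Sum>i\<in>{0<..n}. f (real i))) (at_right 0)"
      by simp
    then show "((\<lambda>e. (LINT s:cut_interval (euler_op f) 0 (real n) e|lborel. euler_op f s) -
          poly [:0, - 2 * w p:] (of_real (1 / e))) \<longlongrightarrow> (\<Sum>i\<in>{0<..n}. f (real i))) (at_right 0)"
    proof (rule Lim_transform_eventually)
      show "\<forall>\<^sub>F e in at_right 0.
          (\<Sum>i\<in>{0<..n}. f (real i)) - ((w (p + e) - w p) /\<^sub>R e - (w (p - e) - w p) /\<^sub>R (- e)) =
          (LINT s:cut_interval (euler_op f) 0 (real n) e|lborel. euler_op f s) -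
            poly [:0, - 2 * w p:] (of_real (1 / e))"
        using ev
      proof eventually_elim
        case (elim e)
        then have "(LINT s:cut_interval (euler_op f) 0 (real n) e|lborel. euler_op f s) =
            (\<Sum>i\<in>{0<..n}. f (real i)) - (w (p + e) + w (p - e)) /\<^sub>R e"
          using cut[of e] by (simp add: has_set_integral_iff)
        moreover have "poly [:0, - 2 * w p:] (of_real (1 / e)) = - (w p /\<^sub>R e + w p /\<^sub>R e)"
          by (simp add: scaleR_conv_of_real divide_inverse)
        ultimately show ?case
          by (simp add: scaleR_diff_right scaleR_add_right)
      qed
    qed
  qed
qed

end

subsection \<open>The double integral\<close>

text \<open>Abel summation, obtained by integrating over the intervals between consecutive integers.\<close>

lemma set_integral_deriv_partial_sums:
  fixes g D :: "real \<Rightarrow> real" and a :: "nat \<Rightarrow> complex"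
  defines "S \<equiv> \<lambda>n. \<Sum>i\<in>{0<..n}. a i"
  assumes g: "\<And>u. 1 \<le> u \<Longrightarrow> (g has_real_derivative D u) (at u)"
    and cont: "continuous_on {1..} D"
    and int: "set_integrable lborel {1<..} D"
    and lim: "(g \<longlongrightarrow> 0) at_top"
    and bound: "\<And>n. norm (S n) \<le> K"
  shows "set_integrable lborel {1<..} (\<lambda>u. of_real (D u) * S (nat \<lfloor>u\<rfloor>))"
    and "(\<lambda>n. a (Suc n) * of_real (g (real (Suc n)))) sums
           (- (LINT u:{1<..}|lborel. of_real (D u) * S (nat \<lfloor>u\<rfloor>)))"
proof -
  define f where "f u = of_real (D u) * S (nat \<lfloor>u\<rfloor>)" for u
  have meas: "(\<lambda>u::real. S (nat \<lfloor>u\<rfloor>)) \<in> borel_measurable borel"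
    by measurable
  have [measurable]: "(\<lambda>u. indicat_real {1<..} u *\<^sub>R D u) \<in> borel_measurable lborel"
    using int unfolding set_integrable_def by (rule borel_measurable_integrable)
  have K: "K \<ge> 0" using norm_ge_zero bound order_trans by blast
  show f_int: "set_integrable lborel {1<..} f"
  proof (rule set_integrable_bound)
    show "set_integrable lborel {1<..} (\<lambda>u. K * D u)"
      using int by simp
    have "(\<lambda>u. of_real (indicat_real {1<..} u *\<^sub>R D u) * S (nat \<lfloor>u\<rfloor>)) \<in> borel_measurable lborel"
      using meas by measurable
    then show "set_borel_measurable lborel {1<..} f"
      unfolding set_borel_measurable_def f_def by (simp add: scaleR_conv_of_real mult_ac)
    show "AE u in lborel. u \<in> {1<..} \<longrightarrow> norm (f u) \<le> norm (K * D u)"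
    proof (intro always_eventually allI impI)
      fix u
      have "norm (f u) = \<bar>D u\<bar> * norm (S (nat \<lfloor>u\<rfloor>))" by (simp add: f_def norm_mult)
      also have "\<dots> \<le> \<bar>D u\<bar> * K" using bound by (intro mult_left_mono) auto
      finally show "norm (f u) \<le> norm (K * D u)" using K by (simp add: abs_mult mult.commute)
    qed
  qed
  have S_Suc: "S (Suc n) = S n + a (Suc n)" for n
  proof -
    have "{0<..Suc n} = insert (Suc n) {0<..n}" by auto
    then show ?thesis by (simp add: S_def)
  qed
  \<comment> \<open>Between n and n + 1 the factor \<open>S\<close> is constant, so the integral is
    a multiple of the increment of \<open>g\<close>.\<close>
  have piece: "has_set_integral f (S n * of_real (g (real (Suc n)) - g (real n))) {real n<..<real (Suc n)}"
    if "n \<ge> 1" for n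
  proof (rule has_set_integral_cong_except[where X = "{real n, real (Suc n)}"])
    have "((\<lambda>u. of_real (g u) * S n) has_vector_derivative of_real (D u) * S n)
        (at u within {real n..real (Suc n)})" if "real n \<le> u" for u
      using that \<open>n \<ge> 1\<close>
      by (intro has_vector_derivative_mult_left has_vector_derivative_of_real
           has_field_derivative_at_within[OF g]) auto
    moreover have "continuous_on {real n..real (Suc n)} D"
      using \<open>n \<ge> 1\<close> by (intro continuous_on_subset[OF cont]) auto
    then have "continuous_on {real n..real (Suc n)} (\<lambda>u. of_real (D u) * S n)"
      by (intro continuous_intros)
    ultimately have "has_set_integral (\<lambda>u. of_real (D u) * S n)
        (of_real (g (real (Suc n))) * S n - of_real (g (real n)) * S n) {real n..real (Suc n)}"
      unfolding has_set_integral_def by (intro has_bochner_integral_FTC_Icc) auto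
    then show "has_set_integral (\<lambda>u. of_real (D u) * S n)
        (S n * of_real (g (real (Suc n)) - g (real n))) {real n..real (Suc n)}"
      by (simp add: algebra_simps)
    fix u assume u: "u \<notin> {real n, real (Suc n)}"
    show "indicat_real {real n..real (Suc n)} u *\<^sub>R (of_real (D u) * S n) =
        indicat_real {real n<..<real (Suc n)} u *\<^sub>R f u"
    proof (cases "u \<in> {real n<..<real (Suc n)}")
      case True
      then have "\<lfloor>u\<rfloor> = int n" by (intro floor_unique) auto
      then show ?thesis using True by (simp add: f_def)
    qed (use u in auto)
  qed auto
  \<comment> \<open>Summation by parts, with boundary term S(n) g(n). At n = 1 the interval is empty
    and the two terms cancel.\<close>
  have partial: "has_set_integral f (S n * of_real (g (real n)) - (\<Sum>i\<in>{0<..n}. a i * of_real (g (real i)))) {1<..<real n}"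
    if "n \<ge> 1" for n
    using that
  proof (induction n rule: dec_induct)
    case base
    have "{0<..Suc 0} = {Suc 0}" by auto
    then show ?case by (simp add: has_set_integral_def has_bochner_integral_zero S_def)
  next
    case (step n)
    have "{0<..Suc n} = insert (Suc n) {0<..n}" by auto
    then have "S (Suc n) * of_real (g (real (Suc n))) - (\<Sum>i\<in>{0<..Suc n}. a i * of_real (g (real i))) =
       (S n * of_real (g (real n)) - (\<Sum>i\<in>{0<..n}. a i * of_real (g (real i)))) +
        S n * of_real (g (real (Suc n)) - g (real n))"
      by (simp add: S_Suc algebra_simps)
    then show ?case
      using has_set_integral_join[OF step.IH piece[OF step.hyps(1)]] step.hyps by simp
  qed
  \<comment> \<open>The half-line is exhausted by the intervals (1, n); below, the boundary term
    vanishes in the limit because \<open>S\<close> is bounded and \<open>g\<close> tends to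
    0.\<close>
  have "(\<lambda>n. LINT u:{1<..<real n}|lborel. f u) \<longlonglongrightarrow> (LINT u:(\<Union>n. {1<..<real n})|lborel. f u)"
  proof (rule set_integral_cont_up)
    have "(\<Union>n. {1<..<real n}) = {1<..}"
      using reals_Archimedean2 by auto
    then show "set_integrable lborel (\<Union>n. {1<..<real n}) f" using f_int by simp
  qed (auto simp: incseq_def)
  moreover have un: "(\<Union>n. {1<..<real n}) = {1<..}"
    using reals_Archimedean2 by auto
  ultimately have L: "(\<lambda>n. LINT u:{1<..<real n}|lborel. f u) \<longlonglongrightarrow> (LINT u:{1<..}|lborel. f u)"
    by simp
  have g0: "(\<lambda>n. g (real n)) \<longlonglongrightarrow> 0"
    by (rule filterlim_compose[OF lim filterlim_real_sequentially])
  have "(\<lambda>n. S n * of_real (g (real n))) \<longlonglongrightarrow> 0"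
  proof (rule Lim_null_comparison)
    show "\<forall>\<^sub>F n in sequentially. norm (S n * of_real (g (real n))) \<le> K * \<bar>g (real n)\<bar>"
      using bound by (intro always_eventually allI) (simp add: norm_mult mult_right_mono)
    show "(\<lambda>n. K * \<bar>g (real n)\<bar>) \<longlonglongrightarrow> 0"
      using tendsto_mult[OF tendsto_const tendsto_rabs[OF g0], of K] by simp
  qed
  from tendsto_diff[OF this L]
  have "(\<lambda>n. S n * of_real (g (real n)) - (LINT u:{1<..<real n}|lborel. f u)) \<longlonglongrightarrow>
      - (LINT u:{1<..}|lborel. f u)" by simp
  then have "(\<lambda>n. \<Sum>i\<in>{0<..n}. a i * of_real (g (real i))) \<longlonglongrightarrow> - (LINT u:{1<..}|lborel. f u)"
  proof (rule Lim_transform_eventually)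
    show "\<forall>\<^sub>F n in sequentially. S n * of_real (g (real n)) - (LINT u:{1<..<real n}|lborel. f u) =
        (\<Sum>i\<in>{0<..n}. a i * of_real (g (real i)))"
      using eventually_ge_at_top[of 1] by eventually_elim (use partial in \<open>simp add: has_set_integral_iff\<close>)
  qed
  moreover have "(\<Sum>i\<in>{0<..n}. a i * of_real (g (real i))) = (\<Sum>i<n. a (Suc i) * of_real (g (real (Suc i))))" for n
    by (rule sum.reindex_bij_witness[where i = Suc and j = "\<lambda>i. i - 1"]) auto
  ultimately show "(\<lambda>n. a (Suc n) * of_real (g (real (Suc n)))) sums (- (LINT u:{1<..}|lborel. f u))"
    by (simp add: sums_def)
qed

section \<open>The coefficient function of the Struve function\<close>

definition struve_numerator :: "real \<Rightarrow> real \<Rightarrow> real \<Rightarrow> complex" where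
  "struve_numerator \<nu> x s =
     ((x / 2) powr s * inverse (Gamma (s + 1) ^ 2)) *\<^sub>R
       (- of_real ((x / 2) powr (\<nu> + 1/2) / Gamma (\<nu> + 1/2)) * exp (\<i> * of_real pi * of_real s))"

text \<open>This exhibits the pole at - (\<nu> + 1/2). The equation holds even there, because
  division by 0 makes both sides 0.\<close>

lemma struve_beta_quotient:
  "struve_beta \<nu> x s / of_real (Gamma (s + 1)) = struve_numerator \<nu> x s /\<^sub>R (s - (- (\<nu> + 1/2)))"
proof -
  have "- c * (E * Y / (G * d)) / G = inverse d * (Y * inverse (G ^ 2) * (- c * E))" for c E Y G d :: complex
    by (simp add: divide_inverse power2_eq_square mult_ac)
  then show ?thesis
    unfolding struve_beta_def struve_numerator_def scaleR_conv_of_real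
    by (simp only: of_real_mult of_real_inverse of_real_power diff_minus_eq_add add.assoc)
qed

text \<open>For s \<ge> 0 the point s + 1 avoids the poles of Gamma, so the real factor has
  logarithmic derivative ln(x/2) - 2 Digamma(s + 1) and the exponential factor is smooth.\<close>

lemma struve_numerator_deriv:
  assumes "x > 0"
  obtains h' where "\<And>s. 0 \<le> s \<Longrightarrow> (struve_numerator \<nu> x has_vector_derivative h' s) (at s)"
    "continuous_on {0..} h'"
proof
  define c where "c = - complex_of_real ((x / 2) powr (\<nu> + 1/2) / Gamma (\<nu> + 1/2))"
  define r where "r s = (x / 2) powr s * inverse (Gamma (s + 1) ^ 2)" for s
  have np: "s + 1 \<notin> \<int>\<^sub>\<le>\<^sub>0" if "s \<ge> 0" for s :: real
    using that nonpos_Ints_nonpos[of "s + 1"] by auto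
  have G: "Gamma (s + 1) > 0" if "s \<ge> 0" for s :: real
    using that by (intro Gamma_real_pos) auto
  have r': "(r has_real_derivative r s * (ln (x / 2) - 2 * Digamma (s + 1))) (at s)" if "s \<ge> 0" for s
    unfolding r_def[abs_def] using assms np[OF that] G[OF that]
    by (auto intro!: derivative_eq_intros simp: field_simps power2_eq_square)
  define h' where "h' s = r s *\<^sub>R (c * (\<i> * of_real pi * exp (\<i> * of_real pi * of_real s))) +
      (r s * (ln (x / 2) - 2 * Digamma (s + 1))) *\<^sub>R (c * exp (\<i> * of_real pi * of_real s))" for s
  show "(struve_numerator \<nu> x has_vector_derivative h' s) (at s)" if "0 \<le> s" for s
    unfolding struve_numerator_def[abs_def] h'_def r_def[symmetric] c_def[symmetric]
  proof (rule has_vector_derivative_scaleR[OF r'[OF that]])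
    show "((\<lambda>s. c * exp (\<i> * of_real pi * of_real s)) has_vector_derivative
        c * (\<i> * of_real pi * exp (\<i> * of_real pi * of_real s))) (at s)"
      by (rule has_vector_derivative_real_field) (auto intro!: derivative_eq_intros)
  qed
  have "continuous_on {0..} r"
    using r' by (intro DERIV_continuous_on[of _ r]) (auto intro: has_field_derivative_at_within)
  moreover have "continuous_on {0..} (\<lambda>s::real. Digamma (s + 1))"
    using np by (intro continuous_at_imp_continuous_on ballI isCont_Polygamma continuous_intros) auto
  ultimately show "continuous_on {0..} h'"
    unfolding h'_def by (intro continuous_intros)
qed

text \<open>The pole p = - (\<nu> + 1/2) is below 3/2. If it lies in [0, n] it is not the integer 1,
  which would mean \<nu> = - 3/2; if it is 0, then f vanishes; otherwise it lies strictly between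
  consecutive integers.\<close>

lemma struve_finite_part_integral:
  fixes \<nu> x :: real and n :: nat
  assumes "\<nu> + 2 > 0" "\<nu> \<noteq> - 3/2" "x > 0"
  defines "f \<equiv> \<lambda>s. struve_beta \<nu> x s / of_real (Gamma (s + 1))"
  shows "has_finite_part_integral (euler_op f) 0 (real n) (\<Sum>i\<in>{0<..n}. f (real i))"
    and "\<nu> \<ge> - 1/2 \<Longrightarrow> set_integrable lborel {0<..<real n} (euler_op f)"
proof -
  define p where "p = - (\<nu> + 1/2)"
  have f: "f = (\<lambda>s. struve_numerator \<nu> x s /\<^sub>R (s - p))"
    unfolding f_def struve_beta_quotient p_def ..
  obtain h' where h': "\<And>s. 0 \<le> s \<Longrightarrow> (struve_numerator \<nu> x has_vector_derivative h' s) (at s)"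
    "continuous_on {0..} h'"
    using struve_numerator_deriv \<open>x > 0\<close> by blast
  have contf: "continuous_on {0..} (struve_numerator \<nu> x)"
    using h'(1) by (intro continuous_at_imp_continuous_on ballI)
      (auto intro: has_vector_derivative_continuous)
  have regular: "has_finite_part_integral (euler_op f) 0 (real n) (\<Sum>i\<in>{0<..n}. f (real i)) \<and>
      set_integrable lborel {0<..<real n} (euler_op f)" if p: "p \<notin> {0..real n}"
  proof -
    define f' where "f' s = inverse (s - p) *\<^sub>R h' s + (- inverse ((s - p)^2)) *\<^sub>R struve_numerator \<nu> x s" for s
    have 1: "(f has_vector_derivative f' s) (at s)" if "0 \<le> s" "s \<le> real n" for s
      unfolding f f'_def using that p
      by (intro has_vector_derivative_scaleR h')
         (auto intro!: derivative_eq_intros simp: power2_eq_square)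
    have 2: "continuous_on {0..real n} f'"
      unfolding f'_def using p
      by (intro continuous_intros continuous_on_subset[OF contf] continuous_on_subset[OF h'(2)]) auto
    show ?thesis
      using has_finite_part_integral_euler_op_regular[OF 1 2] by blast
  qed
  \<comment> \<open>Here Gamma(\<nu> + 1/2) is taken at its pole 0, where its value is 0 by
    convention; dividing by it makes the coefficient function vanish.\<close>
  have zero: "has_finite_part_integral (euler_op f) 0 (real n) (\<Sum>i\<in>{0<..n}. f (real i)) \<and>
      set_integrable lborel {0<..<real n} (euler_op f)" if "\<nu> = - 1/2"
  proof -
    have f0: "f = (\<lambda>_. 0)" unfolding f_def struve_beta_def using that by simp
    have "(f has_vector_derivative 0) (at s)" for s
      unfolding f0 by (rule has_vector_derivative_const)
    from has_finite_part_integral_euler_op_regular[OF this continuous_on_const]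
    show ?thesis by blast
  qed
  show "set_integrable lborel {0<..<real n} (euler_op f)" if "\<nu> \<ge> - 1/2"
  proof (cases "\<nu> = - 1/2")
    case True
    from zero[OF this] show ?thesis by (rule conjunct2)
  next
    case False
    with that have "p \<notin> {0..real n}" by (simp add: p_def)
    from regular[OF this] show ?thesis by (rule conjunct2)
  qed
  show "has_finite_part_integral (euler_op f) 0 (real n) (\<Sum>i\<in>{0<..n}. f (real i))"
  proof -
    consider "\<nu> = -1/2" | "p \<notin> {0..real n}" | "\<nu> \<noteq> -1/2" "0 \<le> p" "p \<le> real n"
      by fastforce
    then show ?thesis
    proof cases
      case 1
      from zero[OF this] show ?thesis by (rule conjunct1)
    next
      case 2
      from regular[OF this] show ?thesis by (rule conjunct1)
    next
      case 3
      define k where "k = nat \<lfloor>p\<rfloor>"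
      have k: "real k \<le> p" "p < real (Suc k)" using 3 unfolding k_def by linarith+
      have "p < 3/2" using assms by (simp add: p_def)
      then have k2: "k < 2" using k by linarith
      have "p \<noteq> 0" "p \<noteq> 1" using 3 assms by (auto simp: p_def)
      then have pk: "p \<noteq> real k" using k2 by (auto simp: less_2_cases_iff)
      \<comment> \<open>As p is not the integer \<open>k\<close>, the bound p \<le> n puts
        \<open>k\<close> strictly below \<open>n\<close>.\<close>
      have "k < n" using 3 k pk by linarith
      \<comment> \<open>This keeps the prefactor 1 / Gamma(\<nu> + 1/2) nonzero, so the numerator
        does not vanish at p and the singularity is genuine.\<close>
      have "\<nu> + 1/2 \<notin> \<int>\<^sub>\<le>\<^sub>0"
      proof
        assume "\<nu> + 1/2 \<in> \<int>\<^sub>\<le>\<^sub>0"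
        then obtain m where "\<nu> + 1/2 = - real m" by (elim nonpos_Ints_cases')
        then have "p = real m" by (simp add: p_def)
        with k have "m = k" by simp
        with \<open>p = real m\<close> pk show False by simp
      qed
      then have "struve_numerator \<nu> x p \<noteq> 0"
        using \<open>x > 0\<close> 3 Gamma_real_pos[of "p + 1"]
        by (auto simp: struve_numerator_def Gamma_eq_zero_iff)
      moreover have "real k < p" using k pk by simp
      ultimately show ?thesis
        using k(2) \<open>k < n\<close> by (intro has_finite_part_integral_euler_op_pole[OF h' _ _ _ _ f])
    qed
  qed
qed

text \<open>Since (x/2)^i \<le> 1 and 1 / (i + \<nu> + 1/2) is bounded, the coefficients are
  dominated by a multiple of 1 / i!.\<close>

lemma struve_beta_partial_sums_bounded:
  fixes \<nu> x :: real
  assumes "0 < x" "x < 2"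
  obtains K where "\<And>n. norm (\<Sum>i\<in>{0<..n}. struve_beta \<nu> x (real i) / of_real (Gamma (real i + 1))) \<le> K"
proof -
  define a where "a i = struve_beta \<nu> x (real i) / of_real (Gamma (real i + 1))" for i
  define C where "C = (x / 2) powr (\<nu> + 1/2) / Gamma (\<nu> + 1/2)"
  define c where "c = \<bar>C\<bar>"
  have "filterlim (\<lambda>k. (\<nu> + 1/2) + real k) at_top sequentially"
    by (rule filterlim_tendsto_add_at_top[OF tendsto_const filterlim_real_sequentially])
  then have "(\<lambda>k. inverse ((\<nu> + 1/2) + real k)) \<longlonglongrightarrow> 0"
    by (rule tendsto_inverse_0_at_top)
  then have "Bseq (\<lambda>k. inverse ((\<nu> + 1/2) + real k))"
    using convergentI convergent_imp_Bseq by blast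
  then obtain M where M: "M > 0" "\<And>k. \<bar>inverse ((\<nu> + 1/2) + real k)\<bar> \<le> M"
    by (auto simp only: Bseq_def real_norm_def)
  \<comment> \<open>The factor \<open>1 ^ i\<close> presents the majorant as an exponential series
    at 1.\<close>
  have a_le: "norm (a i) \<le> c * M * (inverse (fact i) * 1 ^ i)" for i
  proof -
    have G: "Gamma (real i + 1) = fact i" using Gamma_fact[of i] by (simp add: add.commute)
    have E: "norm (exp (\<i> * of_real pi * of_real (real i))) = 1"
      by (simp add: norm_exp_eq_Re)
    have P: "(x / 2) powr real i = (x / 2) ^ i"
      using assms by (simp add: powr_realpow)
    have "norm (a i) = c * ((x / 2) ^ i / (fact i * \<bar>real i + \<nu> + 1/2\<bar>)) / fact i"
      unfolding a_def struve_beta_def G C_def[symmetric] P norm_mult norm_divide norm_minus_cancel E norm_of_real c_def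
      using assms by (simp add: abs_mult)
    also have "\<dots> = c * \<bar>inverse ((\<nu> + 1/2) + real i)\<bar> * ((x / 2) ^ i * inverse (fact i) * inverse (fact i))"
      by (simp only: abs_inverse divide_inverse[of _ "fact i"] divide_inverse[of _ "fact i * _"]
          inverse_mult_distrib add_ac mult_ac)
    also have "\<dots> \<le> c * M * (1 * inverse (fact i) * 1)"
      using assms M by (intro mult_mono power_le_one) (auto simp: c_def inverse_le_1_iff)
    finally show ?thesis by simp
  qed
  have "norm (\<Sum>i\<in>{0<..n}. a i) \<le> (\<Sum>i. c * M * (inverse (fact i) * 1 ^ i))" for n
  proof -
    have "norm (\<Sum>i\<in>{0<..n}. a i) \<le> (\<Sum>i\<in>{0<..n}. c * M * (inverse (fact i) * 1 ^ i))"
      by (intro sum_norm_le a_le)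
    also have "\<dots> \<le> (\<Sum>i. c * M * (inverse (fact i) * 1 ^ i))"
      using M by (intro sum_le_suminf summable_mult summable_exp) (auto simp: c_def)
    finally show ?thesis .
  qed
  then show ?thesis using that unfolding a_def by blast
qed

text \<open>In this order Gamma(n + \<nu> + 3/2) = n!. The lemma serves the degenerate case in which
  \<beta> vanishes and the Struve function must equal the sinh term alone.\<close>

lemma struve_L_minus_half: "struve_L (- 1/2) x = bessel_I (1/2) x"
proof -
  have "Gamma (real n + 1) = fact n" for n
    using Gamma_fact[of n] by (simp add: add.commute)
  then show ?thesis
    unfolding struve_L_def bessel_I_def by (simp add: add_ac)
qed

text \<open>At s = k the exponential is (-1)^k, and Gamma(k + 1) in \<open>gamma_bessel\<close>
  cancels the extra division by Gamma(k + 1). The products are thus the negated terms of the Bessel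
  expansion, whose term of index 0 is the sinh term.\<close>

lemma struve_bessel_sums:
  fixes \<nu> x :: real
  assumes "\<nu> + 2 > 0" "\<nu> \<noteq> - 3/2" "x > 0"
  shows "(\<lambda>n. struve_beta \<nu> x (real (Suc n)) / of_real (Gamma (real (Suc n) + 1)) *
            of_real (gamma_bessel x (real (Suc n)))) sums
         (- of_real (struve_L \<nu> x - x powr \<nu> * sinh x / (2 powr \<nu> * sqrt pi * Gamma (\<nu> + 3/2))))"
proof (cases "\<nu> = - 1/2")
  case True
  have "(x/2) powr (-1/2) = x powr (-1/2) / 2 powr (-1/2)"
    by (rule powr_divide)
  then have "struve_L \<nu> x = x powr \<nu> * sinh x / (2 powr \<nu> * sqrt pi * Gamma (\<nu> + 3/2))"
    using bessel_I_half[OF assms(3)] unfolding True struve_L_minus_half by simp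
  moreover have "struve_beta \<nu> x s = 0" for s
    unfolding struve_beta_def True by simp
  ultimately show ?thesis by simp
next
  case False
  define y where "y = x / 2"
  define c where "c = y powr (\<nu> + 1/2) / Gamma (\<nu> + 1/2)"
  define t where "t k = c * ((-1) ^ k * y ^ k / (fact k * (real k + (\<nu> + 1/2)))) * bessel_I (real k + 1/2) x" for k
  have y: "y > 0" using assms by (simp add: y_def)
  \<comment> \<open>As \<nu> > - 2, the only candidates are \<nu> = - 1/2 and \<nu> = - 3/2, both
    excluded here.\<close>
  have a: "\<nu> + 1/2 \<notin> \<int>\<^sub>\<le>\<^sub>0"
  proof
    assume "\<nu> + 1/2 \<in> \<int>\<^sub>\<le>\<^sub>0"
    then obtain m where m: "\<nu> + 1/2 = - real m" by (elim nonpos_Ints_cases')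
    then have "m < 2" using assms by linarith
    then have "m = 0 \<or> m = 1" by linarith
    then show False using m False assms(2) by auto
  qed
  then have "Gamma (\<nu> + 3/2) = (\<nu> + 1/2) * Gamma (\<nu> + 1/2)"
    using Gamma_plus1[of "\<nu> + 1/2"] by (simp add: add_ac)
  moreover have "y powr (\<nu> + 1/2) * y powr (- 1/2) = x powr \<nu> / 2 powr \<nu>"
    using assms by (simp add: powr_add[symmetric] y_def powr_divide)
  moreover have "t 0 = y powr (\<nu> + 1/2) * y powr (- 1/2) * sinh x /
      (sqrt pi * ((\<nu> + 1/2) * Gamma (\<nu> + 1/2)))"
    using bessel_I_half[OF assms(3)] by (simp add: t_def c_def y_def mult_ac)
  ultimately have t0: "t 0 = x powr \<nu> * sinh x / (2 powr \<nu> * sqrt pi * Gamma (\<nu> + 3/2))"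
    by (simp only: times_divide_eq_left divide_divide_eq_left mult.assoc)
  have "t sums struve_L \<nu> x"
    using struve_L_bessel_series[OF assms(3) a] unfolding t_def c_def y_def .
  then have "(\<lambda>n. t (Suc n)) sums (struve_L \<nu> x - t 0)"
    by (simp add: sums_Suc_iff)
  then have "(\<lambda>n. - complex_of_real (t (Suc n))) sums (- of_real (struve_L \<nu> x - t 0))"
    by (intro sums_minus sums_of_real)
  moreover have "- complex_of_real (t k) = struve_beta \<nu> x (real k) / of_real (Gamma (real k + 1)) *
            of_real (gamma_bessel x (real k))" for k
  proof -
    have G: "Gamma (real k + 1) = fact k" using Gamma_fact[of k] by (simp add: add.commute)
    have e: "exp (\<i> * of_real pi * of_real (real k)) = (-1) ^ k"
      using exp_of_nat_mult[of k "\<i> * of_real pi"] by (simp add: mult_ac)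
    have pw: "(x / 2) powr real k = y ^ k"
      using y by (simp add: y_def powr_realpow)
    have "struve_beta \<nu> x (real k) = - (of_real c * ((-1) ^ k * of_real y ^ k /
        (fact k * (of_nat k + (of_real \<nu> + 1/2)))))"
      unfolding struve_beta_def e pw G by (simp add: c_def y_def add_ac)
    then show ?thesis
      unfolding gamma_bessel_def G by (simp add: t_def mult_ac)
  qed
  ultimately show ?thesis unfolding t0 by simp
qed

text \<open>At \<nu> = - 3/2 the convention 1 / Gamma(-1) = 0 makes \<beta> vanish, while the Struve
  function is the positive I_{3/2}(x) and the sinh term is 0; hence the exclusion. The conjuncts
  before the identity ensure that the finite part, the derivative and the outer integral are genuine
  and not default values.\<close>

theorem theorem4:
  fixes \<nu> x :: real
  assumes "\<nu> + 2 > 0" and "\<nu> \<noteq> - 3/2" and "x \<in> {0<..<2}"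
  shows
    "(\<forall>u>1. \<exists>J. has_finite_part_integral
         (euler_op (\<lambda>s. struve_beta \<nu> x s / of_real (Gamma (s + 1)))) 0 (of_int \<lfloor>u::real\<rfloor>) J) \<and>
     (\<nu> \<ge> - 1/2 \<longrightarrow> (\<forall>u>1. set_integrable lborel {0<..<of_int \<lfloor>u::real\<rfloor>}
         (euler_op (\<lambda>s. struve_beta \<nu> x s / of_real (Gamma (s + 1)))))) \<and>
     (\<forall>u>1. (\<lambda>v. Gamma (v + 1) * bessel_I (v + 1/2) x) differentiable (at u)) \<and>
     set_integrable lborel {1<..} (\<lambda>u.
         of_real (deriv (\<lambda>v. Gamma (v + 1) * bessel_I (v + 1/2) x) u) *
         finite_part_integral
           (euler_op (\<lambda>s. struve_beta \<nu> x s / of_real (Gamma (s + 1)))) 0 (of_int \<lfloor>u\<rfloor>)) \<and>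
     complex_of_real
       (struve_L \<nu> x - x powr \<nu> * sinh x / (2 powr \<nu> * sqrt pi * Gamma (\<nu> + 3/2))) =
     (LINT u:{1<..}|lborel.
         of_real (deriv (\<lambda>v. Gamma (v + 1) * bessel_I (v + 1/2) x) u) *
         finite_part_integral
           (euler_op (\<lambda>s. struve_beta \<nu> x s / of_real (Gamma (s + 1)))) 0 (of_int \<lfloor>u\<rfloor>))"
proof -
  define f where "f = (\<lambda>s. struve_beta \<nu> x s / complex_of_real (Gamma (s + 1)))"
  define S where "S n = (\<Sum>i\<in>{0<..n}. f (real i))" for n :: nat
  have x: "0 < x" "x < 2" using assms by auto
  have floor: "(of_int \<lfloor>u\<rfloor> :: real) = real (nat \<lfloor>u\<rfloor>)" if "u > 1" for u :: real
    using that by simp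
  have fpi: "has_finite_part_integral (euler_op f) 0 (of_int \<lfloor>u\<rfloor>) (S (nat \<lfloor>u\<rfloor>))" if "u > 1" for u :: real
    unfolding floor[OF that] S_def f_def by (rule struve_finite_part_integral(1)[OF assms(1,2) x(1)])
  have integrable: "set_integrable lborel {0<..<of_int \<lfloor>u\<rfloor>} (euler_op f)" if "\<nu> \<ge> - 1/2" "u > 1" for u :: real
    unfolding floor[OF that(2)] f_def
    by (rule struve_finite_part_integral(2)[OF assms(1,2) x(1) that(1)])
  have g: "(\<lambda>v. Gamma (v + 1) * bessel_I (v + 1/2) x) = gamma_bessel x"
    by (simp add: fun_eq_iff gamma_bessel_def)
  have deriv: "(gamma_bessel x has_real_derivative deriv (gamma_bessel x) u) (at u)" if "u \<ge> 1" for u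
    using gamma_bessel_has_derivative[OF x, of u] deriv_gamma_bessel[OF x, of u] that by simp
  obtain K where K: "\<And>n. norm (\<Sum>i\<in>{0<..n}. f (real i)) \<le> K"
    using struve_beta_partial_sums_bounded[OF x] unfolding f_def by blast
  have cont: "continuous_on {1..} (deriv (gamma_bessel x))"
    by (rule continuous_on_subset[OF continuous_on_deriv_gamma_bessel[OF x]]) auto
  \<comment> \<open>Abel summation with a_i = f(i) and g = \<open>gamma_bessel x\<close>; comparing
    the resulting sum with the Bessel expansion identifies the outer integral.\<close>
  note main = set_integral_deriv_partial_sums[OF deriv cont
      set_integrable_deriv_gamma_bessel[OF x] gamma_bessel_tendsto_0[OF x] K, folded S_def]
  have "(\<lambda>n. f (real (Suc n)) * of_real (gamma_bessel x (real (Suc n)))) sums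
      (- of_real (struve_L \<nu> x - x powr \<nu> * sinh x / (2 powr \<nu> * sqrt pi * Gamma (\<nu> + 3/2))))"
    unfolding f_def by (rule struve_bessel_sums[OF assms(1,2) x(1)])
  from sums_unique2[OF this main(2)]
  have eq: "complex_of_real (struve_L \<nu> x - x powr \<nu> * sinh x / (2 powr \<nu> * sqrt pi * Gamma (\<nu> + 3/2))) =
      (LINT u:{1<..}|lborel. of_real (deriv (gamma_bessel x) u) * S (nat \<lfloor>u\<rfloor>))"
    by (simp only: neg_equal_iff_equal)
  have S: "finite_part_integral (euler_op f) 0 (of_int \<lfloor>u\<rfloor>) = S (nat \<lfloor>u\<rfloor>)" if "u > 1" for u :: real
    using fpi[OF that] by (rule finite_part_integral_eqI)
  show ?thesis
    unfolding g f_def[symmetric]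
  proof (intro conjI allI impI)
    show "gamma_bessel x differentiable (at u)" if "u > 1" for u
      using deriv[of u] that by (auto simp: real_differentiable_def)
    show "set_integrable lborel {1<..} (\<lambda>u. of_real (deriv (gamma_bessel x) u) *
        finite_part_integral (euler_op f) 0 (of_int \<lfloor>u\<rfloor>))"
      using main(1) by (subst set_integrable_cong[OF refl refl]) (auto simp: S)
    show "complex_of_real (struve_L \<nu> x - x powr \<nu> * sinh x / (2 powr \<nu> * sqrt pi * Gamma (\<nu> + 3/2))) =
      (LINT u:{1<..}|lborel. of_real (deriv (gamma_bessel x) u) *
        finite_part_integral (euler_op f) 0 (of_int \<lfloor>u\<rfloor>))"
      unfolding eq by (rule set_lebesgue_integral_cong) (auto simp: S)
  qed (use fpi integrable in auto)
qed

end
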